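(* Let $(\mathfrak{H},[\cdot,\cdot])$ be a Krein space with fundamental symmetry $J$, let $\mathcal{F}=\{f_n\}_{n\in\mathbb{N}}$ be a $J$-orthogonal Schauder basis of $(\mathfrak{H},(\cdot,\cdot))$ which is a $J$-frame, with associated subspaces $\mathcal{M}_\pm$, and suppose that $\mathcal{M}_+\dot{+}\mathcal{M}_-\neq\mathfrak{H}$. Let $$\mathcal{D}_{un}=\Big\{f\in\mathfrak{H}:\ \text{the series }\sum_{n=1}^\infty\frac{[f,f_n]}{[f_n,f_n]}f_n\text{ converges unconditionally in }\mathfrak{H}\Big\}.$$ Then $$\mathcal{D}_{un}\subset\mathcal{M}_+\dot{+}\mathcal{M}_-\subset\mathfrak{D},$$ where the inclusions are strict and $\mathfrak{D}$ is the energetic linear manifold. Moreover, $f\in\mathfrak{H}$ belongs to $\mathcal{D}_{un}$ if $\{[f,f_n]\}$ belongs to $l_1(\mathbb{N})$.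
   Context: A Krein space $(\mathfrak{H},[\cdot,\cdot])$ is a complex (infinite-dimensional) linear space with an indefinite inner product admitting a fundamental decomposition $\mathfrak{H}=\mathfrak{H}_+[\dot{+}]\mathfrak{H}_-$, a $[\cdot,\cdot]$-orthogonal direct sum of Hilbert spaces $(\mathfrak{H}_+,[\cdot,\cdot])$ and $(\mathfrak{H}_-,-[\cdot,\cdot])$. A fundamental decomposition is fixed; its fundamental symmetry is $J(f_++f_-)=f_+-f_-$ ($f_\pm\in\mathfrak{H}_\pm$), and $(\cdot,\cdot)=[J\cdot,\cdot]$, $\|\cdot\|=\sqrt{(\cdot,\cdot)}$ is the associated Hilbert space inner product and norm. Subspaces are closed and topological notions refer to $\|\cdot\|$. A subspace $\mathcal{L}$ is positive (negative) if $[f,f]>0$ ($[f,f]<0$) for all nonzero $f\in\mathcal{L}$, and maximal positive (negative) if it is not a proper subspace of another positive (negative) subspace. A sequence is $J$-orthogonal if $[f_n,f_m]=0$ for $n\ne m$. For $\mathcal{F}=\{f_n\}$ put $\mathbb{N}_+=\{n:[f_n,f_n]\ge0\}$, $\mathbb{N}_-=\{n:[f_n,f_n]<0\}$, $\mathcal{F}_\pm=\{f_n\}_{n\in\mathbb{N}_\pm}$, $\mathcal{M}_\pm=\overline{\mathrm{span}\,\mathcal{F}_\pm}$. $\mathcal{F}$ is a $J$-frame if $\mathcal{M}_+$ is maximal positive, $\mathcal{M}_-$ is maximal negative, and there are constants $0<A\le B$ with $A|[f,f]|\le\sum_{n\in\mathbb{N}_+}|[f,f_n]|^2\le B|[f,f]|$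 for all $f\in\mathrm{span}\,\mathcal{F}_+$, and $A|[f,f]|\le\sum_{n\in\mathbb{N}_-}|[f,f_n]|^2\le B|[f,f]|$ for all $f\in\mathrm{span}\,\mathcal{F}_-$. Energetic linear manifold: here $\mathcal{M}_\pm$ are $J$-orthogonal. Let $\mathcal{D}=\mathcal{M}_+\dot{+}\mathcal{M}_-$ and $J_{\mathcal{M}}(f_{\mathcal{M}_+}+f_{\mathcal{M}_-})=f_{\mathcal{M}_+}-f_{\mathcal{M}_-}$ with domain $\mathcal{D}$ ($f_{\mathcal{M}_\pm}\in\mathcal{M}_\pm$). Since $\mathcal{M}_\pm$ are maximal definite and $J$-orthogonal, $JJ_{\mathcal{M}}$ is a positive self-adjoint operator in $(\mathfrak{H},(\cdot,\cdot))$, written $e^Q=JJ_{\mathcal{M}}$ with $Q$ self-adjoint. $\mathfrak{D}$ is the completion of $\mathcal{D}$ in the energetic norm $\|f\|_{en}^2=\|f\|^2+(e^Qf,f)$; as a set, $\mathfrak{D}=\mathcal{D}(e^{Q/2})\subset\mathfrak{H}$. *)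

theory Defs
  imports "HOL-Analysis.Analysis" "HOL-Library.Set_Algebras"
begin

section \<open>Complex vector spaces\<close>

class complex_vector = scaleR + ab_group_add +
  fixes scaleC :: "complex \<Rightarrow> 'a \<Rightarrow> 'a"  (infixr "*\<^sub>C" 75)
  assumes scaleC_add_right: "a *\<^sub>C (x + y) = a *\<^sub>C x + a *\<^sub>C y"
    and scaleC_add_left: "(a + b) *\<^sub>C x = a *\<^sub>C x + b *\<^sub>C x"
    and scaleC_scaleC: "a *\<^sub>C (b *\<^sub>C x) = (a * b) *\<^sub>C x"
    and scaleC_one: "1 *\<^sub>C x = x"
    and scaleR_scaleC: "r *\<^sub>R x = complex_of_real r *\<^sub>C x"

definition (in complex_vector) csubspace :: "'a set \<Rightarrow> bool" where
  "csubspace S \<longleftrightarrow> 0 \<in> S \<and> (\<forall>x\<in>S. \<forall>y\<in>S. x + y \<in> S) \<and> (\<forall>c. \<forall>x\<in>S. c *\<^sub>C x \<in> S)"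

global_interpretation complex_vector:
  vector_space "scaleC :: complex \<Rightarrow> 'a \<Rightarrow> 'a::complex_vector"
  rewrites "module.subspace scaleC = csubspace"
  defines cspan = complex_vector.span
proof -
  show vs: "vector_space (scaleC :: complex \<Rightarrow> 'a \<Rightarrow> 'a)"
    by unfold_locales (simp_all add: scaleC_add_right scaleC_add_left scaleC_scaleC scaleC_one)
  then interpret vector_space "scaleC :: complex \<Rightarrow> 'a \<Rightarrow> 'a" .
  show "subspace = csubspace"
    by (rule ext) (simp only: subspace_def csubspace_def)
qed

section \<open>Krein spaces\<close>

text \<open>
  The map \<open>l + m \<mapsto> l - m\<close> for \<open>l \<in> L\<close>, \<open>m \<in> M\<close>. It is meaningful only on \<open>L + M\<close>, and only if
  the sum is direct; see \<open>reflection_eq\<close>.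
\<close>

definition (in ab_group_add) reflection :: "'a set \<Rightarrow> 'a set \<Rightarrow> 'a \<Rightarrow> 'a" where
  "reflection L M f = (THE g. \<exists>l\<in>L. \<exists>m\<in>M. f = l + m \<and> g = l - m)"

text \<open>
  A Krein space with a fixed fundamental decomposition \<open>Hpos [+] Hneg\<close>. The indefinite inner
  product \<open>kprod\<close> is linear in its first argument. The norm of the type (hence its topology) is
  \<open>sqrt [J f, f]\<close>, which on \<open>Hpos\<close> and \<open>Hneg\<close> is the norm of \<open>[\<cdot>,\<cdot>]\<close> and of \<open>- [\<cdot>,\<cdot>]\<close>; so the two
  completeness axioms say that these are Hilbert spaces.
\<close>

class krein_space = complex_vector + real_normed_vector +
  fixes kprod :: "'a \<Rightarrow> 'a \<Rightarrow> complex"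
    and Hpos :: "'a set"
    and Hneg :: "'a set"
  assumes kprod_add_left: "kprod (x + y) z = kprod x z + kprod y z"
    and kprod_scaleC_left: "kprod (a *\<^sub>C x) y = a * kprod x y"
    and kprod_commute: "kprod x y = cnj (kprod y x)"
    and Hpos_subspace: "csubspace Hpos"
    and Hneg_subspace: "csubspace Hneg"
    and Hpos_pos: "x \<in> Hpos \<Longrightarrow> x \<noteq> 0 \<Longrightarrow> 0 < Re (kprod x x)"
    and Hneg_neg: "x \<in> Hneg \<Longrightarrow> x \<noteq> 0 \<Longrightarrow> Re (kprod x x) < 0"
    and Hpos_Hneg_orthogonal: "x \<in> Hpos \<Longrightarrow> y \<in> Hneg \<Longrightarrow> kprod x y = 0"
    and fundamental_decomposition: "\<exists>p\<in>Hpos. \<exists>m\<in>Hneg. x = p + m"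
    and norm_eq_sqrt_kprod: "norm x = sqrt (Re (kprod (reflection Hpos Hneg x) x))"
    and Hpos_complete:
      "(\<And>n. X n \<in> Hpos) \<Longrightarrow> (\<And>e. 0 < e \<Longrightarrow> \<exists>N. \<forall>m\<ge>N. \<forall>n\<ge>N. norm (X m - X n) < e)
        \<Longrightarrow> \<exists>l\<in>Hpos. (\<lambda>n. norm (X n - l)) \<longlonglongrightarrow> 0"
    and Hneg_complete:
      "(\<And>n. X n \<in> Hneg) \<Longrightarrow> (\<And>e. 0 < e \<Longrightarrow> \<exists>N. \<forall>m\<ge>N. \<forall>n\<ge>N. norm (X m - X n) < e)
        \<Longrightarrow> \<exists>l\<in>Hneg. (\<lambda>n. norm (X n - l)) \<longlonglongrightarrow> 0"
    and infinite_dimensional: "finite B \<Longrightarrow> \<exists>x. \<forall>c. x \<noteq> (\<Sum>b\<in>B. c b *\<^sub>C b)"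

definition fund_sym :: "'a::krein_space \<Rightarrow> 'a" where
  "fund_sym = reflection Hpos Hneg"

definition hprod :: "'a::krein_space \<Rightarrow> 'a \<Rightarrow> complex" where
  "hprod f g = kprod (fund_sym f) g"

definition positive_subspace :: "'a::krein_space set \<Rightarrow> bool" where
  "positive_subspace L \<longleftrightarrow> csubspace L \<and> closed L \<and> (\<forall>f\<in>L. f \<noteq> 0 \<longrightarrow> Re (kprod f f) > 0)"

definition negative_subspace :: "'a::krein_space set \<Rightarrow> bool" where
  "negative_subspace L \<longleftrightarrow> csubspace L \<and> closed L \<and> (\<forall>f\<in>L. f \<noteq> 0 \<longrightarrow> Re (kprod f f) < 0)"

definition maximal_positive :: "'a::krein_space set \<Rightarrow> bool" where
  "maximal_positive L \<longleftrightarrow> positive_subspace L \<and> \<not> (\<exists>L'. positive_subspace L' \<and> L \<subset> L')"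

definition maximal_negative :: "'a::krein_space set \<Rightarrow> bool" where
  "maximal_negative L \<longleftrightarrow> negative_subspace L \<and> \<not> (\<exists>L'. negative_subspace L' \<and> L \<subset> L')"

section \<open>Schauder bases and \<open>J\<close>-frames\<close>

text \<open>Sequences \<open>f\<^sub>1, f\<^sub>2, \<dots>\<close> are indexed by \<^typ>\<open>nat\<close>, that is, from \<open>0\<close>.\<close>

definition J_orthogonal :: "(nat \<Rightarrow> 'a::krein_space) \<Rightarrow> bool" where
  "J_orthogonal F \<longleftrightarrow> (\<forall>n m. n \<noteq> m \<longrightarrow> kprod (F n) (F m) = 0)"

definition schauder_basis :: "(nat \<Rightarrow> 'a::krein_space) \<Rightarrow> bool" where
  "schauder_basis F \<longleftrightarrow> (\<forall>f. \<exists>!c :: nat \<Rightarrow> complex. (\<lambda>n. c n *\<^sub>C F n) sums f)"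

definition N_plus :: "(nat \<Rightarrow> 'a::krein_space) \<Rightarrow> nat set" where
  "N_plus F = {n. Re (kprod (F n) (F n)) \<ge> 0}"

definition N_minus :: "(nat \<Rightarrow> 'a::krein_space) \<Rightarrow> nat set" where
  "N_minus F = {n. Re (kprod (F n) (F n)) < 0}"

definition M_plus :: "(nat \<Rightarrow> 'a::krein_space) \<Rightarrow> 'a set" where
  "M_plus F = closure (cspan (F ` N_plus F))"

definition M_minus :: "(nat \<Rightarrow> 'a::krein_space) \<Rightarrow> 'a set" where
  "M_minus F = closure (cspan (F ` N_minus F))"

text \<open>
  The frame inequalities on a linear manifold \<open>S\<close>, for the members of \<open>F\<close> with index in \<open>N\<close>. The
  upper bound entails convergence of the sum, which has to be stated separately.
\<close>

definition frame_bounds ::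
    "real \<Rightarrow> real \<Rightarrow> (nat \<Rightarrow> 'a::krein_space) \<Rightarrow> nat set \<Rightarrow> 'a set \<Rightarrow> bool" where
  "frame_bounds A B F N S \<longleftrightarrow>
     (\<forall>f\<in>S. (\<lambda>n. (cmod (kprod f (F n)))\<^sup>2) summable_on N \<and>
            A * cmod (kprod f f) \<le> (\<Sum>\<^sub>\<infinity>n\<in>N. (cmod (kprod f (F n)))\<^sup>2) \<and>
            (\<Sum>\<^sub>\<infinity>n\<in>N. (cmod (kprod f (F n)))\<^sup>2) \<le> B * cmod (kprod f f))"

definition J_frame :: "(nat \<Rightarrow> 'a::krein_space) \<Rightarrow> bool" where
  "J_frame F \<longleftrightarrow>
     maximal_positive (M_plus F) \<and> maximal_negative (M_minus F) \<and>
     (\<exists>A B. 0 < A \<and> A \<le> B \<and>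
        frame_bounds A B F (N_plus F) (cspan (F ` N_plus F)) \<and>
        frame_bounds A B F (N_minus F) (cspan (F ` N_minus F)))"

section \<open>The energetic linear manifold\<close>

definition J_M :: "(nat \<Rightarrow> 'a::krein_space) \<Rightarrow> 'a \<Rightarrow> 'a" where
  "J_M F = reflection (M_plus F) (M_minus F)"

text \<open>The operator \<open>e\<^sup>Q = J J\<^sub>M\<close>, with domain \<open>M_plus F + M_minus F\<close>.\<close>

definition exp_Q :: "(nat \<Rightarrow> 'a::krein_space) \<Rightarrow> 'a \<Rightarrow> 'a" where
  "exp_Q F f = fund_sym (J_M F f)"

definition energetic_norm :: "(nat \<Rightarrow> 'a::krein_space) \<Rightarrow> 'a \<Rightarrow> real" where
  "energetic_norm F f = sqrt ((norm f)\<^sup>2 + Re (hprod (exp_Q F f) f))"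

definition energetic_Cauchy :: "(nat \<Rightarrow> 'a::krein_space) \<Rightarrow> (nat \<Rightarrow> 'a) \<Rightarrow> bool" where
  "energetic_Cauchy F g \<longleftrightarrow>
     (\<forall>e>0. \<exists>N. \<forall>m\<ge>N. \<forall>n\<ge>N. energetic_norm F (g m - g n) < e)"

text \<open>
  The completion of \<open>M_plus F + M_minus F\<close> in the energetic norm, realized inside the Krein space: an
  energetic Cauchy sequence is a Cauchy sequence, and the element of the completion it represents is
  identified with its limit. The identification is injective because \<open>e\<^sup>Q\<close> is positive and symmetric:
  its form is closable, so an energetic Cauchy sequence with limit \<open>0\<close> is energetically null. The
  resulting set is the domain of \<open>e\<^bsup>Q/2\<^esup>\<close>.
\<close>

definition energetic_manifold :: "(nat \<Rightarrow> 'a::krein_space) \<Rightarrow> 'a set" where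
  "energetic_manifold F =
     {f. \<exists>g. (\<forall>n. g n \<in> M_plus F + M_minus F) \<and> energetic_Cauchy F g \<and> g \<longlonglongrightarrow> f}"

section \<open>Unconditional convergence\<close>

definition unconditionally_convergent :: "(nat \<Rightarrow> 'a::real_normed_vector) \<Rightarrow> bool" where
  "unconditionally_convergent x \<longleftrightarrow> (\<forall>\<pi>. bij \<pi> \<longrightarrow> summable (\<lambda>n. x (\<pi> n)))"

definition D_un :: "(nat \<Rightarrow> 'a::krein_space) \<Rightarrow> 'a set" where
  "D_un F =
     {f. unconditionally_convergent (\<lambda>n. (kprod f (F n) / kprod (F n) (F n)) *\<^sub>C F n)}"

section \<open>Consistency of the definitions\<close>

lemma reflection_eq:
  fixes L M :: "'a::complex_vector set"
  assumes L: "csubspace L" and M: "csubspace M" and LM: "L \<inter> M \<subseteq> {0}"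
    and l: "l \<in> L" and m: "m \<in> M"
  shows "reflection L M (l + m) = l - m"
  unfolding reflection_def
proof (rule the_equality)
  show "\<exists>l'\<in>L. \<exists>m'\<in>M. l + m = l' + m' \<and> l - m = l' - m'"
    using l m by blast
next
  fix g assume "\<exists>l'\<in>L. \<exists>m'\<in>M. l + m = l' + m' \<and> g = l' - m'"
  then obtain l' m' where l': "l' \<in> L" and m': "m' \<in> M" and eq: "l + m = l' + m'"
    and g: "g = l' - m'" by blast
  have d: "l - l' = m' - m"
    using eq by (metis add.commute add_diff_cancel_left' diff_add_eq diff_diff_eq2)
  have "l - l' \<in> L" using L l l' by (rule complex_vector.subspace_diff)
  moreover have "m' - m \<in> M" using M m' m by (rule complex_vector.subspace_diff)
  ultimately have "l - l' = 0" using d LM by auto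
  then show "g = l - m" using d g by simp
qed

lemma fund_sym_eq:
  fixes p m :: "'a::krein_space"
  assumes "p \<in> Hpos" "m \<in> Hneg"
  shows "fund_sym (p + m) = p - m"
proof -
  have "(Hpos :: 'a set) \<inter> Hneg \<subseteq> {0}"
    using Hpos_pos Hneg_neg by (metis (no_types) Int_iff insert_iff not_less_iff_gr_or_eq subsetI)
  then show ?thesis
    unfolding fund_sym_def using Hpos_subspace Hneg_subspace assms by (intro reflection_eq)
qed

lemma complete_Hpos: "complete (Hpos :: 'a::krein_space set)"
  unfolding complete_def
proof (intro allI impI, elim conjE)
  fix X :: "nat \<Rightarrow> 'a" assume "\<forall>n. X n \<in> Hpos" and "Cauchy X"
  then have "\<exists>l\<in>Hpos. (\<lambda>n. norm (X n - l)) \<longlonglongrightarrow> 0"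
    by (intro Hpos_complete) (auto simp: Cauchy_iff)
  then show "\<exists>l\<in>Hpos. X \<longlonglongrightarrow> l"
    by (metis LIM_zero_iff tendsto_norm_zero_iff)
qed

lemma complete_Hneg: "complete (Hneg :: 'a::krein_space set)"
  unfolding complete_def
proof (intro allI impI, elim conjE)
  fix X :: "nat \<Rightarrow> 'a" assume "\<forall>n. X n \<in> Hneg" and "Cauchy X"
  then have "\<exists>l\<in>Hneg. (\<lambda>n. norm (X n - l)) \<longlonglongrightarrow> 0"
    by (intro Hneg_complete) (auto simp: Cauchy_iff)
  then show "\<exists>l\<in>Hneg. X \<longlonglongrightarrow> l"
    by (metis LIM_zero_iff tendsto_norm_zero_iff)
qed

lemma Hpos_plus_Hneg: "(Hpos :: 'a::krein_space set) + Hneg = UNIV"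
  using fundamental_decomposition by (fastforce simp: set_plus_def)

lemma infinite_dimensional_cspan:
  fixes B :: "'a::krein_space set"
  assumes "finite B"
  shows "cspan B \<noteq> UNIV"
  using infinite_dimensional[OF assms] complex_vector.span_finite[OF assms] by fastforce

lemma norm_eq_sqrt_hprod: "norm f = sqrt (Re (hprod f f))"
  by (simp add: hprod_def fund_sym_def norm_eq_sqrt_kprod)

lemma J_frame_direct_sum:
  assumes "J_frame F"
  shows "M_plus F \<inter> M_minus F \<subseteq> {0}"
  using assms unfolding J_frame_def maximal_positive_def maximal_negative_def
    positive_subspace_def negative_subspace_def
  by (metis (no_types) Int_iff insert_iff not_less_iff_gr_or_eq subsetI)

lemma J_M_eq:
  assumes F: "J_frame F" and "p \<in> M_plus F" "m \<in> M_minus F"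
  shows "J_M F (p + m) = p - m"
proof -
  have "csubspace (M_plus F)" "csubspace (M_minus F)"
    using F unfolding J_frame_def maximal_positive_def maximal_negative_def
      positive_subspace_def negative_subspace_def by blast+
  then show ?thesis
    unfolding J_M_def using J_frame_direct_sum[OF F] assms(2,3) by (intro reflection_eq)
qed

end

theory Submission
  imports Defs
begin

text \<open>
  A Schauder basis expansion that converges unconditionally splits along \<open>N_plus\<close> and \<open>N_minus\<close>, and
  for a \<open>J\<close>-frame the vectors \<open>F n\<close> and the numbers \<open>[F n, F n]\<close> are bounded above and away from \<open>0\<close>;
  this gives the first inclusion and the summability criterion. Since \<open>M_plus + M_minus\<close> is dense, it
  is the whole space as soon as its projection onto \<open>M_plus\<close> is bounded, so each strictness claim is
  reduced to a bound on this projection.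

  If every \<open>p \<in> M_plus\<close> had an unconditionally convergent expansion, uniform boundedness together
  with a choice of signs \<open>\<epsilon>\<^sub>n\<close> such that \<open>\<parallel>\<Sum>n. \<epsilon>\<^sub>n v\<^sub>n\<parallel>\<^sup>2 \<le> \<Sum>n. \<parallel>v\<^sub>n\<parallel>\<^sup>2\<close> would give \<open>\<parallel>p\<parallel>\<^sup>2 \<le> K [p, p]\<close>, and
  \<open>[p, p] = [p + m, p]\<close> bounds the projection. If \<open>M_plus + M_minus\<close> were complete in the energetic
  norm, the form \<open>[J_M f, f]\<close> would be bounded on it, so by the Cauchy-Schwarz inequality and density
  \<open>J_M\<close> would be bounded, and hence the projection.
\<close>

section \<open>Positive semidefinite forms and uniform boundedness\<close>

text \<open>The quadratic form at \<open>r *\<^sub>R x + s *\<^sub>R y\<close> is nonnegative for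
  all real \<open>r\<close> and \<open>s\<close>. Everything is relative to \<open>V\<close> because
  \<open>J_M\<close> is meaningful only on \<open>M_plus F + M_minus F\<close>.\<close>

lemma real_form_Cauchy_Schwarz:
  fixes b :: "'a::real_vector \<Rightarrow> 'a \<Rightarrow> real"
  assumes V: "subspace V"
    and add: "\<And>x y z. x \<in> V \<Longrightarrow> y \<in> V \<Longrightarrow> z \<in> V \<Longrightarrow> b (x + y) z = b x z + b y z"
    and scale: "\<And>r x z. x \<in> V \<Longrightarrow> z \<in> V \<Longrightarrow> b (r *\<^sub>R x) z = r * b x z"
    and sym: "\<And>x y. x \<in> V \<Longrightarrow> y \<in> V \<Longrightarrow> b x y = b y x"
    and pos: "\<And>x. x \<in> V \<Longrightarrow> 0 \<le> b x x"
    and x: "x \<in> V" and y: "y \<in> V"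
  shows "(b x y)\<^sup>2 \<le> b x x * b y y"
proof -
  have expand: "b (r *\<^sub>R x + s *\<^sub>R y) (r *\<^sub>R x + s *\<^sub>R y) = r\<^sup>2 * b x x + 2 * r * s * b x y + s\<^sup>2 * b y y"
    for r s
  proof -
    have rx: "r *\<^sub>R x \<in> V" and sy: "s *\<^sub>R y \<in> V" using V x y by (auto simp: subspace_scale)
    let ?u = "r *\<^sub>R x + s *\<^sub>R y"
    have u: "?u \<in> V" using V rx sy by (rule subspace_add)
    have 1: "b x ?u = r * b x x + s * b x y"
      using sym[OF x u] add[OF rx sy x] scale[OF x x] scale[OF y x] sym[OF x y] by simp
    have 2: "b y ?u = r * b x y + s * b y y"
      using sym[OF y u] add[OF rx sy y] scale[OF x y] scale[OF y y] by simp
    show ?thesis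
      using add[OF rx sy u] scale[OF x u] scale[OF y u]
      by (simp add: 1 2 algebra_simps power2_eq_square)
  qed
  have nonneg: "0 \<le> r\<^sup>2 * b x x + 2 * r * s * b x y + s\<^sup>2 * b y y" for r s
    using expand[of r s] pos V x y by (metis subspace_add subspace_scale)
  show ?thesis
  proof (cases "b y y = 0")
    case True
    have "b x y = 0"
    proof (rule ccontr)
      assume "b x y \<noteq> 0"
      \<comment> \<open>This choice of \<open>s\<close> makes the quadratic form equal to
        \<open>-1\<close>.\<close>
      then show False
        using nonneg[of 1 "- (b x x + 1) / (2 * b x y)"] pos[OF x] True by (simp add: field_simps)
    qed
    then show ?thesis using True by simp
  next
    case False
    then have "0 < b y y" using pos[OF y] by simp
    \<comment> \<open>For \<open>r = b y y\<close>, the value \<open>s = - b x y\<close> minimises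
      the quadratic form.\<close>
    moreover have "0 \<le> b y y * (b x x * b y y - (b x y)\<^sup>2)"
      using nonneg[of "b y y" "- b x y"] by (simp add: power2_eq_square algebra_simps)
    ultimately show ?thesis by (simp add: zero_le_mult_iff)
  qed
qed

text \<open>Otherwise there are nested balls with centres in \<open>V\<close> and radii tending to
  \<open>0\<close> such that some \<open>L i\<close> has norm at least \<open>k\<close> on all of
  ball \<open>k + 1\<close>. The centres converge in \<open>V\<close>, and at their limit the family
  is unbounded.\<close>

lemma uniform_boundedness:
  fixes L :: "'i \<Rightarrow> 'a::real_normed_vector \<Rightarrow> 'b::real_normed_vector"
  assumes V: "subspace V" "complete V"
    and L: "\<And>i. i \<in> I \<Longrightarrow> bounded_linear (L i)"
    and ptw: "\<And>x. x \<in> V \<Longrightarrow> \<exists>b. \<forall>i\<in>I. norm (L i x) \<le> b"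
  shows "\<exists>K\<ge>0. \<forall>i\<in>I. \<forall>x\<in>V. norm (L i x) \<le> K * norm x"
proof (rule ccontr)
  assume "\<not> ?thesis"
  then have unbounded: "\<exists>i\<in>I. \<exists>x\<in>V. K * norm x < norm (L i x)" if "0 \<le> K" for K
    using that by (meson not_le)
  define P where "P = (\<lambda>(k::nat) (x::'a, d::real). x \<in> V \<and> 0 < d \<and> d \<le> (1/2) ^ k)"
  define Q where "Q = (\<lambda>(k::nat) (x::'a, d::real) (x'::'a, d'::real). cball x' d' \<subseteq> cball x d \<and>
      (\<exists>i\<in>I. \<forall>z\<in>cball x' d'. real k \<le> norm (L i z)))"
  have step: "\<exists>y. P (Suc k) y \<and> Q k s y" if "P k s" for k s
  proof -
    obtain x d where s: "s = (x, d)" by force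
    have x: "x \<in> V" and d: "0 < d" "d \<le> (1/2) ^ k" using that by (auto simp: P_def s)
    obtain i v where i: "i \<in> I" and v: "v \<in> V"
      and big: "4 * (real k + 1) / d * norm v < norm (L i v)"
      using unbounded[of "4 * (real k + 1) / d"] d by auto
    interpret Li: bounded_linear "L i" using L[OF i] .
    have v0: "0 < norm v" using big Li.zero by auto
    \<comment> \<open>\<open>u\<close> has length \<open>d / 2\<close>, so the factor
      \<open>4 * (real k + 1) / d\<close> yields \<open>norm (L i u) > 2 * (real k + 1)\<close>;
      hence \<open>L i\<close> exceeds \<open>real k + 1\<close> in norm at \<open>x\<close> or at
      \<open>x + u\<close>.\<close>
    define u where "u = (d / (2 * norm v)) *\<^sub>R v"
    have u: "u \<in> V" "norm u \<le> d / 2" using V v d v0 by (auto simp: u_def subspace_scale)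
    have "norm (L i u) = d / (2 * norm v) * norm (L i v)" using d by (simp add: u_def Li.scaleR)
    also have "\<dots> > d / (2 * norm v) * (4 * (real k + 1) / d * norm v)"
      using big d v0 by (intro mult_strict_left_mono) auto
    also have "d / (2 * norm v) * (4 * (real k + 1) / d * norm v) = 2 * (real k + 1)"
      using d v0 by (simp add: field_simps)
    finally have "2 * (real k + 1) < norm (L i u)" .
    also have "norm (L i u) \<le> norm (L i (x + u)) + norm (L i x)"
      by (metis Li.add add_diff_cancel_left' norm_triangle_ineq4)
    finally have "real k + 1 < norm (L i x) \<or> real k + 1 < norm (L i (x + u))" by argo
    then obtain x' where x': "x' \<in> V" "dist x x' \<le> d / 2" "real k + 1 < norm (L i x')"
      using x u d V subspace_add[of V x u] by (auto simp: dist_norm)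
    have "isCont (\<lambda>z. norm (L i z)) x'"
      using Li.continuous[OF continuous_ident] by (intro continuous_intros)
    then obtain e where e: "e > 0" "\<And>z. dist z x' < e \<Longrightarrow> dist (norm (L i z)) (norm (L i x')) < 1"
      unfolding continuous_at_eps_delta by (metis zero_less_one)
    \<comment> \<open>Radius \<open>e / 2\<close> keeps \<open>norm (L i z)\<close> within
      \<open>1\<close> of its value at \<open>x'\<close>; radius \<open>d / 2\<close> keeps the new
      ball inside the old one, as \<open>dist x x' \<le> d / 2\<close>.\<close>
    define d' where "d' = min (e / 2) (d / 2)"
    have "real k \<le> norm (L i z)" if "z \<in> cball x' d'" for z
      using that e(2)[of z] e(1) x'(3) by (auto simp: d'_def dist_commute dist_real_def)
    moreover have "cball x' d' \<subseteq> cball x d"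
    proof
      fix z assume "z \<in> cball x' d'"
      then show "z \<in> cball x d"
        using x'(2) dist_triangle[of x z x'] by (auto simp: d'_def)
    qed
    ultimately have "P (Suc k) (x', d') \<and> Q k s (x', d')"
      using x' e d i unfolding P_def Q_def s prod.case by (intro conjI bexI[of _ i]) (auto simp: d'_def)
    then show ?thesis by blast
  qed
  have "P 0 (0, 1)" using V subspace_0 by (auto simp: P_def)
  then obtain f where f: "\<And>k. P k (f k)" "\<And>k. Q k (f k) (f (Suc k))"
    using dependent_nat_choice[of P Q] step by metis
  define X where "X k = fst (f k)" for k
  define R where "R k = snd (f k)" for k
  have X: "X k \<in> V" "0 < R k" "R k \<le> (1/2) ^ k" for k
    using f(1)[of k] by (auto simp: P_def X_def R_def split: prod.splits)
  have nest: "cball (X (Suc k)) (R (Suc k)) \<subseteq> cball (X k) (R k)" for k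
    using f(2)[of k] by (auto simp: Q_def X_def R_def split: prod.splits)
  have large: "\<exists>i\<in>I. \<forall>z\<in>cball (X (Suc k)) (R (Suc k)). real k \<le> norm (L i z)" for k
    using f(2)[of k] by (auto simp: Q_def X_def R_def split: prod.splits)
  have sub: "cball (X n) (R n) \<subseteq> cball (X m) (R m)" if "m \<le> n" for m n
    using nest by (rule lift_Suc_antimono_le) (rule that)
  then have ball: "X n \<in> cball (X m) (R m)" if "m \<le> n" for m n
    using X(2)[of n] that by (meson centre_in_cball less_imp_le subsetD)
  have "Cauchy X"
  proof (rule metric_CauchyI)
    fix e :: real assume "0 < e"
    then obtain N where N: "(1/2) ^ N < e / 2"
      using real_arch_pow_inv[of "e / 2" "1/2"] by auto
    have "dist (X m) (X n) < e" if "N \<le> m" "N \<le> n" for m n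
      using ball[OF that(1)] ball[OF that(2)] X(3)[of N] N
        dist_triangle2[of "X m" "X n" "X N"] dist_commute[of "X N"] by auto
    then show "\<exists>M. \<forall>m\<ge>M. \<forall>n\<ge>M. dist (X m) (X n) < e" by blast
  qed
  then obtain l where l: "l \<in> V" "X \<longlonglongrightarrow> l"
    using V(2) X(1) unfolding complete_def by blast
  have "l \<in> cball (X m) (R m)" for m
    using ball l(2) by (intro Lim_in_closed_set[of _ X sequentially]) (auto simp: eventually_sequentially)
  then have "\<exists>i\<in>I. real k \<le> norm (L i l)" for k
    using large[of k] by blast
  moreover obtain b where "\<forall>i\<in>I. norm (L i l) \<le> b" using ptw[OF l(1)] by blast
  moreover obtain k where "b < real k" using reals_Archimedean2 by blast
  ultimately show False by (meson dual_order.trans not_le)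
qed

section \<open>Krein spaces as Banach spaces\<close>

lemma scaleC_zero_left [simp]: "0 *\<^sub>C x = (0::'a::complex_vector)"
  by (rule complex_vector.scale_zero_left)

lemma scaleC_minus1: "(- 1) *\<^sub>C x = - (x::'a::complex_vector)"
  using complex_vector.scale_minus_left[of 1 x] by (simp add: scaleC_one)

lemma csubspace_imp_subspace:
  fixes V :: "'a::krein_space set"
  assumes "csubspace V"
  shows "subspace V"
  using assms unfolding csubspace_def subspace_def by (simp add: scaleR_scaleC)

section \<open>The fundamental symmetry as a linear involution\<close>

lemma Hpos_Hneg_decomp:
  fixes x :: "'a::krein_space"
  obtains p m where "p \<in> Hpos" "m \<in> Hneg" "x = p + m" "fund_sym x = p - m"
  using fundamental_decomposition[of x] fund_sym_eq by metis

lemma fund_sym_add: "fund_sym (x + y) = fund_sym x + fund_sym (y::'a::krein_space)"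
proof -
  obtain p m where x: "p \<in> Hpos" "m \<in> Hneg" "x = p + m" "fund_sym x = p - m"
    by (rule Hpos_Hneg_decomp)
  obtain q n where y: "q \<in> Hpos" "n \<in> Hneg" "y = q + n" "fund_sym y = q - n"
    by (rule Hpos_Hneg_decomp)
  have "fund_sym ((p + q) + (m + n)) = (p + q) - (m + n)"
    using x y Hpos_subspace Hneg_subspace by (intro fund_sym_eq) (auto simp: csubspace_def)
  moreover have "x + y = (p + q) + (m + n)" by (simp add: x(3) y(3))
  ultimately show ?thesis unfolding x(4) y(4) by simp
qed

lemma fund_sym_scaleC: "fund_sym (c *\<^sub>C x) = c *\<^sub>C fund_sym (x::'a::krein_space)"
proof -
  obtain p m where x: "p \<in> Hpos" "m \<in> Hneg" "x = p + m" "fund_sym x = p - m"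
    by (rule Hpos_Hneg_decomp)
  have "fund_sym (c *\<^sub>C p + c *\<^sub>C m) = c *\<^sub>C p - c *\<^sub>C m"
    using x Hpos_subspace Hneg_subspace by (intro fund_sym_eq) (auto simp: csubspace_def)
  moreover have "c *\<^sub>C x = c *\<^sub>C p + c *\<^sub>C m" by (simp add: x(3) scaleC_add_right)
  ultimately show ?thesis
    unfolding x(4) by (simp add: complex_vector.scale_right_diff_distrib)
qed

lemma fund_sym_scaleR: "fund_sym (r *\<^sub>R x) = r *\<^sub>R fund_sym (x::'a::krein_space)"
  by (simp add: scaleR_scaleC fund_sym_scaleC)

lemma fund_sym_idem [simp]: "fund_sym (fund_sym x) = (x::'a::krein_space)"
proof -
  obtain p m where x: "p \<in> Hpos" "m \<in> Hneg" "x = p + m" "fund_sym x = p - m"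
    by (rule Hpos_Hneg_decomp)
  have "- m \<in> Hneg" using x(2) Hneg_subspace by (metis csubspace_def scaleC_minus1)
  then have "fund_sym (p + - m) = p - - m" using x(1) by (intro fund_sym_eq)
  then show ?thesis using x by simp
qed

section \<open>Algebra of the indefinite inner product\<close>

lemma kprod_add_right: "kprod x (y + z) = kprod x y + kprod x (z::'a::krein_space)"
  using kprod_commute[of x] kprod_commute[of y x] kprod_commute[of z x] by (simp add: kprod_add_left)

lemma kprod_scaleC_right: "kprod x (c *\<^sub>C y) = cnj c * kprod x (y::'a::krein_space)"
  using kprod_commute[of x] kprod_commute[of y x] by (simp add: kprod_scaleC_left)

lemma kprod_scaleR_left: "kprod (r *\<^sub>R x) y = r *\<^sub>R kprod x (y::'a::krein_space)"
  by (simp add: scaleR_scaleC kprod_scaleC_left scaleR_conv_of_real)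

lemma kprod_scaleR_right: "kprod x (r *\<^sub>R y) = r *\<^sub>R kprod x (y::'a::krein_space)"
  by (simp add: scaleR_scaleC kprod_scaleC_right scaleR_conv_of_real)

lemma Im_kprod_self [simp]: "Im (kprod x x) = 0" for x :: "'a::krein_space"
  using kprod_commute[of x x] by (metis Reals_cnj_iff complex_is_Real_iff)

lemma Re_kprod_commute: "Re (kprod x y) = Re (kprod y x)" for x :: "'a::krein_space"
  by (subst kprod_commute) simp

lemma kprod_zero_left [simp]: "kprod 0 x = 0" for x :: "'a::krein_space"
  using kprod_scaleC_left[of 0 0 x] by simp

lemma kprod_diff_left: "kprod (x - y) z = kprod x z - kprod y z" for x :: "'a::krein_space"
  using kprod_add_left[of "x - y" y z] by simp

lemma kprod_diff_right: "kprod x (y - z) = kprod x y - kprod x z" for x :: "'a::krein_space"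
  using kprod_add_right[of x "y - z" z] by simp

lemma Hneg_Hpos_orthogonal: "x \<in> Hneg \<Longrightarrow> y \<in> Hpos \<Longrightarrow> kprod x y = 0" for x :: "'a::krein_space"
  using kprod_commute[of x y] Hpos_Hneg_orthogonal[of y x] by simp

lemma kprod_fund_sym: "kprod (fund_sym x) y = kprod x (fund_sym y)" for x :: "'a::krein_space"
proof -
  obtain p m where x: "p \<in> Hpos" "m \<in> Hneg" "x = p + m" "fund_sym x = p - m"
    by (rule Hpos_Hneg_decomp)
  obtain q n where y: "q \<in> Hpos" "n \<in> Hneg" "y = q + n" "fund_sym y = q - n"
    by (rule Hpos_Hneg_decomp)
  have "kprod (p - m) (q + n) = kprod (p + m) (q - n)"
    using x(1,2) y(1,2)
    by (simp add: Hpos_Hneg_orthogonal Hneg_Hpos_orthogonal kprod_add_left kprod_add_right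
        kprod_diff_left kprod_diff_right)
  then show ?thesis using x(3,4) y(3,4) by simp
qed

section \<open>The Hilbert norm and continuity of the operations\<close>

lemma power2_norm_eq_kprod: "(norm x)\<^sup>2 = Re (kprod (fund_sym x) x)" for x :: "'a::krein_space"
proof -
  have "0 \<le> Re (kprod (fund_sym x) x)"
    using norm_eq_sqrt_kprod[of x] norm_ge_zero[of x] by (simp add: fund_sym_def)
  then show ?thesis using norm_eq_sqrt_kprod[of x] by (simp add: fund_sym_def)
qed

lemma norm_fund_sym [simp]: "norm (fund_sym x) = norm x" for x :: "'a::krein_space"
proof -
  have "(norm (fund_sym x))\<^sup>2 = (norm x)\<^sup>2"
    unfolding power2_norm_eq_kprod by (simp add: Re_kprod_commute)
  then show ?thesis by (simp add: power2_eq_iff_nonneg)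
qed

lemma norm_scaleC: "norm (c *\<^sub>C x) = cmod c * norm (x::'a::krein_space)"
proof -
  have "(norm (c *\<^sub>C x))\<^sup>2 = Re (c * cnj c * kprod (fund_sym x) x)"
    unfolding power2_norm_eq_kprod
    by (simp only: fund_sym_scaleC kprod_scaleC_left kprod_scaleC_right mult.assoc mult.left_commute)
  also have "\<dots> = (cmod c * norm x)\<^sup>2"
    unfolding complex_norm_square[symmetric] power_mult_distrib power2_norm_eq_kprod
    by simp
  finally show ?thesis by (simp add: power2_eq_iff_nonneg)
qed

lemma bounded_bilinear_scaleC: "bounded_bilinear (\<lambda>c (x::'a::krein_space). c *\<^sub>C x)"
proof
  show "\<exists>K. \<forall>a b. norm (a *\<^sub>C (b::'a)) \<le> norm a * norm b * K"
    by (intro exI[of _ 1]) (simp add: norm_scaleC)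
qed (simp_all add: scaleC_add_left scaleC_add_right scaleR_scaleC scaleC_scaleC
       scaleR_conv_of_real mult.commute)

text \<open>\<open>kprod x y\<close> is the Hilbert inner product of \<open>fund_sym x\<close> and
  \<open>y\<close>, and \<open>fund_sym\<close> is isometric, so this is the Cauchy-Schwarz
  inequality, proved first for real parts.\<close>

lemma norm_kprod_le: "cmod (kprod x y) \<le> norm x * norm y" for x y :: "'a::krein_space"
proof -
  have re: "Re (kprod (fund_sym u) v) \<le> norm u * norm v" for u v :: 'a
  proof -
    have "(Re (kprod (fund_sym u) v))\<^sup>2 \<le> Re (kprod (fund_sym u) u) * Re (kprod (fund_sym v) v)"
    proof (rule real_form_Cauchy_Schwarz[of UNIV "\<lambda>u v. Re (kprod (fund_sym u) v)"])
      show "Re (kprod (fund_sym x) y) = Re (kprod (fund_sym y) x)" for x y :: 'a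
        using kprod_fund_sym Re_kprod_commute by metis
      show "0 \<le> Re (kprod (fund_sym x) x)" for x :: 'a
        by (metis power2_norm_eq_kprod zero_le_power2)
    qed (simp_all add: fund_sym_add fund_sym_scaleR kprod_add_left kprod_scaleR_left)
    then have "(Re (kprod (fund_sym u) v))\<^sup>2 \<le> (norm u * norm v)\<^sup>2"
      by (simp add: power2_norm_eq_kprod power_mult_distrib)
    then show ?thesis by (rule power2_le_imp_le) simp
  qed
  \<comment> \<open>The phase \<open>c\<close> turns \<open>kprod x y\<close> into its modulus.
    Since \<open>sgn 0 = 0\<close>, only \<open>cmod c \<le> 1\<close> holds in general.\<close>
  define c where "c = cnj (sgn (kprod x y))"
  have "complex_of_real (cmod (kprod x y)) = kprod (c *\<^sub>C x) y"
  proof (cases "kprod x y = 0")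
    case False
    then have "c * kprod x y = kprod x y * cnj (kprod x y) / complex_of_real (cmod (kprod x y))"
      unfolding c_def by (simp add: sgn_div_norm scaleR_conv_of_real field_simps)
    then show ?thesis
      using False by (simp add: kprod_scaleC_left complex_norm_square[symmetric] power2_eq_square)
  qed (simp add: kprod_scaleC_left)
  then have "cmod (kprod x y) = Re (kprod (fund_sym (fund_sym (c *\<^sub>C x))) y)"
    by (metis Re_complex_of_real fund_sym_idem)
  also have "\<dots> \<le> cmod c * norm x * norm y"
    using re[of "fund_sym (c *\<^sub>C x)" y] by (simp add: norm_scaleC)
  also have "\<dots> \<le> 1 * norm x * norm y"
    by (intro mult_right_mono) (auto simp: c_def norm_sgn)
  finally show ?thesis by simp
qed

lemma bounded_bilinear_kprod: "bounded_bilinear (kprod :: 'a::krein_space \<Rightarrow> 'a \<Rightarrow> complex)"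
proof
  show "\<exists>K. \<forall>a b. norm (kprod a (b::'a)) \<le> norm a * norm b * K"
    by (intro exI[of _ 1]) (simp add: norm_kprod_le)
qed (simp_all add: kprod_add_left kprod_add_right kprod_scaleR_left kprod_scaleR_right)

interpretation kprod: bounded_bilinear "kprod :: 'a::krein_space \<Rightarrow> 'a \<Rightarrow> complex"
  by (rule bounded_bilinear_kprod)

interpretation scaleC: bounded_bilinear "\<lambda>c (x::'a::krein_space). c *\<^sub>C x"
  by (rule bounded_bilinear_scaleC)

lemma bounded_linear_fund_sym: "bounded_linear (fund_sym :: 'a::krein_space \<Rightarrow> 'a)"
  by (rule bounded_linear_intro[of _ 1]) (simp_all add: fund_sym_add fund_sym_scaleR)

lemmas fund_sym_diff = linear_diff[OF bounded_linear.linear[OF bounded_linear_fund_sym]]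

text \<open>\<open>x + fund_sym x\<close> and \<open>x - fund_sym x\<close> are twice the components
  of \<open>x\<close> in \<open>Hpos\<close> and \<open>Hneg\<close>; for a Cauchy sequence both
  converge, because these subspaces are complete.\<close>

instance krein_space \<subseteq> banach
proof
  fix X :: "nat \<Rightarrow> 'a::krein_space" assume X: "Cauchy X"
  have lim: "\<exists>l. (\<lambda>n. X n + s *\<^sub>R fund_sym (X n)) \<longlonglongrightarrow> l"
    if "complete V" "\<And>x. x + s *\<^sub>R fund_sym x \<in> V" for V :: "'a set" and s :: real
  proof -
    have "bounded_linear (\<lambda>x::'a. x + s *\<^sub>R fund_sym x)"
      by (intro bounded_linear_add bounded_linear_ident bounded_linear_fund_sym
          bounded_linear_compose[OF bounded_linear_scaleR_right])
    then have "Cauchy (\<lambda>n. X n + s *\<^sub>R fund_sym (X n))"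
      using X by (rule bounded_linear.Cauchy)
    then show ?thesis
      using that unfolding complete_def by metis
  qed
  have pos: "x + 1 *\<^sub>R fund_sym x \<in> Hpos" and neg: "x + (-1) *\<^sub>R fund_sym x \<in> Hneg" for x :: 'a
  proof -
    obtain p m where x: "p \<in> Hpos" "m \<in> Hneg" "x = p + m" "fund_sym x = p - m"
      by (rule Hpos_Hneg_decomp)
    then have "x + 1 *\<^sub>R fund_sym x = p + p" "x + (-1) *\<^sub>R fund_sym x = m + m" by simp_all
    then show "x + 1 *\<^sub>R fund_sym x \<in> Hpos" "x + (-1) *\<^sub>R fund_sym x \<in> Hneg"
      using x(1,2) Hpos_subspace Hneg_subspace by (auto simp: csubspace_def)
  qed
  obtain p where p: "(\<lambda>n. X n + 1 *\<^sub>R fund_sym (X n)) \<longlonglongrightarrow> p"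
    using lim[OF complete_Hpos pos] by blast
  obtain m where m: "(\<lambda>n. X n + (-1) *\<^sub>R fund_sym (X n)) \<longlonglongrightarrow> m"
    using lim[OF complete_Hneg neg] by blast
  have "(\<lambda>n. (1/2) *\<^sub>R ((X n + 1 *\<^sub>R fund_sym (X n)) + (X n + (-1) *\<^sub>R fund_sym (X n))))
      \<longlonglongrightarrow> (1/2) *\<^sub>R (p + m)"
    by (intro tendsto_intros p m)
  moreover have "(1/2) *\<^sub>R ((X n + 1 *\<^sub>R fund_sym (X n)) + (X n + (-1) *\<^sub>R fund_sym (X n))) = X n" for n
    by (simp flip: scaleR_2)
  ultimately show "convergent X" unfolding convergent_def by auto
qed

lemma parallelogram_law:
  "(norm (x + y))\<^sup>2 + (norm (x - y))\<^sup>2 = 2 * (norm x)\<^sup>2 + 2 * (norm y)\<^sup>2" for x y :: "'a::krein_space"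
  unfolding power2_norm_eq_kprod
  by (simp add: fund_sym_diff fund_sym_add kprod.diff_left kprod.diff_right kprod.add_left
      kprod.add_right)

section \<open>Unconditional convergence\<close>

text \<open>
  Otherwise there are successive intervals \<open>I\<^sub>k\<close> with subsets \<open>S\<^sub>k\<close> whose sums stay away from \<open>0\<close>. The
  permutation that moves \<open>S\<^sub>k\<close> to the front of \<open>I\<^sub>k\<close>, for every \<open>k\<close>, destroys convergence.
\<close>

lemma unconditionally_convergent_Cauchy:
  fixes x :: "nat \<Rightarrow> 'a::banach"
  assumes x: "unconditionally_convergent x" and e: "0 < e"
  shows "\<exists>N. \<forall>S. finite S \<and> S \<subseteq> {N..} \<longrightarrow> norm (sum x S) < e"
proof (rule ccontr)
  assume "\<not> ?thesis"
  then have bad: "\<exists>S. finite S \<and> S \<subseteq> {N..} \<and> e \<le> norm (sum x S)" for N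
    by (meson not_le)
  have step: "\<exists>m'. m < m' \<and> (\<exists>S\<subseteq>{m..<m'}. e \<le> norm (sum x S))" for m
  proof -
    obtain S where S: "finite S" "S \<subseteq> {m..}" "e \<le> norm (sum x S)" using bad by blast
    have "S \<noteq> {}" using S(3) e by auto
    then have "m < Suc (Max S)" using S by (auto simp: less_Suc_eq_le subset_iff Max_ge_iff)
    moreover have "S \<subseteq> {m..<Suc (Max S)}" using S by (auto simp: less_Suc_eq_le)
    ultimately show ?thesis using S(3) by blast
  qed
  \<comment> \<open>The clause for \<open>k = 0\<close> fixes \<open>m 0 = 0\<close>, so that the
    intervals cover every index.\<close>
  have "\<exists>m. \<forall>k. (k = 0 \<longrightarrow> m k = (0::nat)) \<and>
      m k < m (Suc k) \<and> (\<exists>S\<subseteq>{m k..<m (Suc k)}. e \<le> norm (sum x S))"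
    by (rule dependent_nat_choice) (use step in auto)
  then obtain m :: "nat \<Rightarrow> nat" where m0: "m 0 = 0"
    and m: "\<And>k. m k < m (Suc k) \<and> (\<exists>S\<subseteq>{m k..<m (Suc k)}. e \<le> norm (sum x S))"
    by blast
  obtain S where S: "\<And>k. S k \<subseteq> {m k..<m (Suc k)}" "\<And>k. e \<le> norm (sum x (S k))"
    using m by metis
  have mono: "strict_mono m" using m by (simp add: strict_mono_Suc_iff)
  define I where "I k = {m k..<m (Suc k)}" for k
  have fin: "finite (S k)" for k using S(1) finite_subset by blast
  have "\<exists>\<sigma>. bij_betw \<sigma> (I k) (I k) \<and> bij_betw \<sigma> {m k..<m k + card (S k)} (S k)" for k
  proof -
    let ?A = "{m k..<m k + card (S k)}"
    have card: "card (S k) \<le> card (I k)" using S(1) by (intro card_mono) (auto simp: I_def)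
    have A: "?A \<subseteq> I k" using card by (auto simp: I_def)
    obtain g where g: "bij_betw g ?A (S k)"
      using fin by (metis card_atLeastLessThan diff_add_inverse finite_atLeastLessThan
          finite_same_card_bij)
    \<comment> \<open>Equal cardinalities of the complements let the bijection onto
      \<open>S k\<close> be completed to a permutation of \<open>I k\<close>.\<close>
    have "card (I k - ?A) = card (I k - S k)"
      using A S(1)[of k] fin by (subst (1 2) card_Diff_subset) (auto simp: I_def)
    then obtain h where h: "bij_betw h (I k - ?A) (I k - S k)"
      by (metis I_def finite_Diff finite_atLeastLessThan finite_same_card_bij)
    let ?s = "\<lambda>i. if i \<in> ?A then g i else h i"
    have 1: "bij_betw ?s ?A (S k)" using g by (subst bij_betw_cong[where g = g]) auto
    have 2: "bij_betw ?s (I k - ?A) (I k - S k)" using h by (subst bij_betw_cong[where g = h]) auto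
    have "bij_betw ?s (?A \<union> (I k - ?A)) (S k \<union> (I k - S k))"
      using 1 2 by (rule bij_betw_combine) auto
    moreover have "?A \<union> (I k - ?A) = I k" "S k \<union> (I k - S k) = I k"
      using A S(1)[of k] by (auto simp: I_def)
    ultimately show ?thesis using 1 by metis
  qed
  then obtain \<sigma> where \<sigma>: "\<And>k. bij_betw (\<sigma> k) (I k) (I k)"
    "\<And>k. bij_betw (\<sigma> k) {m k..<m k + card (S k)} (S k)" by metis
  \<comment> \<open>The number of the interval that contains \<open>i\<close>; the permutations of
    the single intervals are glued along it.\<close>
  define \<kappa> where "\<kappa> i = (LEAST k. i < m (Suc k))" for i
  have \<kappa>: "\<kappa> i = k" if "i \<in> I k" for i k
    unfolding \<kappa>_def
  proof (rule Least_equality)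
    show "i < m (Suc k)" using that by (simp add: I_def)
    show "k \<le> j" if "i < m (Suc j)" for j
    proof (rule ccontr)
      assume "\<not> k \<le> j"
      then have "m (Suc j) \<le> m k" using mono by (simp add: strict_mono_less_eq Suc_le_eq)
      then show False using that \<open>i \<in> I k\<close> by (auto simp: I_def)
    qed
  qed
  have ex: "i \<in> I (\<kappa> i)" for i
  proof -
    have "i < m (Suc i)" using mono by (meson Suc_le_lessD strict_mono_imp_increasing)
    then have "i < m (Suc (\<kappa> i))" unfolding \<kappa>_def by (rule LeastI)
    moreover have "m (\<kappa> i) \<le> i"
    proof (cases "\<kappa> i")
      case (Suc j)
      then have "\<not> i < m (Suc j)" using not_less_Least[of j "\<lambda>k. i < m (Suc k)"] by (auto simp: \<kappa>_def)
      then show ?thesis using Suc by simp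
    qed (simp add: m0)
    ultimately show ?thesis by (simp add: I_def)
  qed
  then have cover: "(\<Union>k. I k) = UNIV" by blast
  define \<pi> where "\<pi> i = \<sigma> (\<kappa> i) i" for i
  have "bij_betw \<pi> (\<Union>k. I k) (\<Union>k. I k)"
  proof (rule bij_betw_UNION_disjoint)
    show "disjoint_family_on I UNIV" unfolding disjoint_family_on_def by (metis \<kappa> disjoint_iff)
    show "bij_betw \<pi> (I k) (I k)" for k
      using \<sigma>(1)[of k] \<kappa> by (subst bij_betw_cong[where g = "\<sigma> k"]) (auto simp: \<pi>_def)
  qed
  then have "summable (\<lambda>n. x (\<pi> n))"
    using x cover unfolding unconditionally_convergent_def by simp
  then obtain N where N: "\<And>a b. N \<le> a \<Longrightarrow> norm (\<Sum>n\<in>{a..<b}. x (\<pi> n)) < e"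
    using e unfolding summable_Cauchy by blast
  have sub: "{m N..<m N + card (S N)} \<subseteq> I N"
    using card_mono[OF _ S(1)[of N]] by (auto simp: I_def)
  have "(\<Sum>n\<in>{m N..<m N + card (S N)}. x (\<pi> n)) = (\<Sum>n\<in>{m N..<m N + card (S N)}. x (\<sigma> N n))"
    using sub \<kappa> by (intro sum.cong) (auto simp: \<pi>_def)
  also have "\<dots> = sum x (S N)" by (rule sum.reindex_bij_betw) (rule \<sigma>)
  \<comment> \<open>The Cauchy criterion covers the front segment of \<open>I N\<close>, because
    \<open>N \<le> m N\<close>.\<close>
  finally show False
    using N[of "m N" "m N + card (S N)"] S(2)[of N] strict_mono_imp_increasing[OF mono, of N] by simp
qed

text \<open>The Cauchy criterion over arbitrary finite index sets applies to
  \<open>{m..<k} \<inter> A\<close>.\<close>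

lemma unconditionally_convergent_imp_summable_subseries:
  fixes x :: "nat \<Rightarrow> 'a::banach"
  assumes "unconditionally_convergent x"
  shows "summable (\<lambda>n. if n \<in> A then x n else 0)"
  unfolding summable_Cauchy
proof (intro allI impI)
  fix e :: real assume "0 < e"
  then obtain N where N: "\<And>S. finite S \<Longrightarrow> S \<subseteq> {N..} \<Longrightarrow> norm (sum x S) < e"
    using unconditionally_convergent_Cauchy[OF assms] by metis
  have "norm (\<Sum>n\<in>{m..<k}. if n \<in> A then x n else 0) < e" if "N \<le> m" for m k
  proof -
    have "norm (sum x ({m..<k} \<inter> A)) < e" using that by (intro N) auto
    then show ?thesis by (simp add: sum.If_cases)
  qed
  then show "\<exists>N. \<forall>m\<ge>N. \<forall>k. norm (\<Sum>n\<in>{m..<k}. if n \<in> A then x n else 0) < e" by blast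
qed

text \<open>Finite sums beyond some \<open>N\<close> stay below \<open>1\<close>, and finitely many
  terms remain. This is the pointwise bound that uniform boundedness requires.\<close>

lemma unconditionally_convergent_imp_bounded_sums:
  fixes x :: "nat \<Rightarrow> 'a::banach"
  assumes "unconditionally_convergent x"
  shows "\<exists>b. \<forall>S. finite S \<longrightarrow> norm (sum x S) \<le> b"
proof -
  obtain N where N: "\<And>S. finite S \<Longrightarrow> S \<subseteq> {N..} \<Longrightarrow> norm (sum x S) < 1"
    using unconditionally_convergent_Cauchy[OF assms zero_less_one] by metis
  have "norm (sum x S) \<le> (\<Sum>n<N. norm (x n)) + 1" if "finite S" for S
  proof -
    have "sum x S = sum x (S \<inter> {..<N}) + sum x (S - {..<N})"
      using that by (rule sum.Int_Diff)
    moreover have "norm (sum x (S \<inter> {..<N})) \<le> (\<Sum>n<N. norm (x n))"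
      by (rule order_trans[OF norm_sum]) (rule sum_mono2, auto)
    moreover have "norm (sum x (S - {..<N})) < 1"
      using that by (intro N) auto
    ultimately show ?thesis
      using norm_triangle_ineq[of "sum x (S \<inter> {..<N})" "sum x (S - {..<N})"] by simp
  qed
  then show ?thesis by blast
qed

lemma summable_norm_imp_unconditionally_convergent:
  fixes x :: "nat \<Rightarrow> 'a::banach"
  assumes "summable (\<lambda>n. norm (x n))"
  shows "unconditionally_convergent x"
  unfolding unconditionally_convergent_def
proof (intro allI impI)
  fix \<pi> :: "nat \<Rightarrow> nat" assume "bij \<pi>"
  then have "summable ((\<lambda>n. norm (x n)) \<circ> \<pi>)"
    using assms by (intro summable_reindex) (auto simp: bij_is_inj)
  then show "summable (\<lambda>n. x (\<pi> n))" unfolding o_def by (rule summable_norm_cancel)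
qed

text \<open>The sign is \<open>+\<close> on \<open>T\<close> and \<open>-\<close> on
  \<open>S - T\<close>. Signs are chosen one by one: by the parallelogram law, the squared norm of
  \<open>a + v i\<close> or of \<open>a - v i\<close> is at most
  \<open>(norm a)\<^sup>2 + (norm (v i))\<^sup>2\<close>.\<close>

lemma exists_signs_norm_sum_le:
  fixes v :: "'i \<Rightarrow> 'a::krein_space"
  assumes "finite S"
  shows "\<exists>T\<subseteq>S. (norm (sum v T - sum v (S - T)))\<^sup>2 \<le> (\<Sum>i\<in>S. (norm (v i))\<^sup>2)"
  using assms
proof induction
  case (insert i S)
  then obtain T where T: "T \<subseteq> S" "(norm (sum v T - sum v (S - T)))\<^sup>2 \<le> (\<Sum>i\<in>S. (norm (v i))\<^sup>2)"
    by blast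
  let ?a = "sum v T - sum v (S - T)"
  have fin: "finite T" "i \<notin> T" using T insert finite_subset by auto
  have "insert i S - insert i T = S - T" "insert i S - T = insert i (S - T)"
    using insert fin by auto
  then have eqs: "sum v (insert i T) - sum v (insert i S - insert i T) = ?a + v i"
    "sum v T - sum v (insert i S - T) = ?a - v i"
    using fin insert by simp_all
  have "(\<Sum>j\<in>insert i S. (norm (v j))\<^sup>2) = (\<Sum>j\<in>S. (norm (v j))\<^sup>2) + (norm (v i))\<^sup>2"
    using insert(1,2) by simp
  moreover have "(norm (?a + v i))\<^sup>2 \<le> (norm ?a)\<^sup>2 + (norm (v i))\<^sup>2 \<or>
      (norm (?a - v i))\<^sup>2 \<le> (norm ?a)\<^sup>2 + (norm (v i))\<^sup>2"
    using parallelogram_law[of ?a "v i"] by linarith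
  ultimately have "(norm (sum v (insert i T) - sum v (insert i S - insert i T)))\<^sup>2
        \<le> (\<Sum>j\<in>insert i S. (norm (v j))\<^sup>2) \<or>
      (norm (sum v T - sum v (insert i S - T)))\<^sup>2 \<le> (\<Sum>j\<in>insert i S. (norm (v j))\<^sup>2)"
    unfolding eqs using T(2) by argo
  moreover have "insert i T \<subseteq> insert i S" "T \<subseteq> insert i S" using T by auto
  ultimately show ?case by blast
qed simp

section \<open>Expansions in a \<open>J\<close>-orthogonal basis that is a \<open>J\<close>-frame\<close>

lemma closure_cspan_subset:
  fixes V :: "'a::krein_space set"
  assumes "csubspace V" "closed V" "X \<subseteq> V"
  shows "closure (cspan X) \<subseteq> V"
  using assms by (intro closure_minimal complex_vector.span_minimal)

lemma closure_cspan_superset: "X \<subseteq> closure (cspan X)" for X :: "'a::krein_space set"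
  using complex_vector.span_superset closure_subset by fast

text \<open>With one argument fixed, the zeros of the form in the other argument are a closed
  subspace; this is applied to each argument in turn.\<close>

lemma kprod_closure_cspan_eq_0:
  fixes X Y :: "'a::krein_space set"
  assumes "\<And>x y. x \<in> X \<Longrightarrow> y \<in> Y \<Longrightarrow> kprod x y = 0"
    and x: "x \<in> closure (cspan X)" and y: "y \<in> closure (cspan Y)"
  shows "kprod x y = 0"
proof -
  have "closure (cspan X) \<subseteq> {x. kprod x y = 0}" if "y \<in> Y" for y
    using assms(1) that
    by (intro closure_cspan_subset closed_Collect_eq kprod.continuous_on continuous_intros)
      (auto simp: csubspace_def kprod_add_left kprod_scaleC_left)
  then have "closure (cspan Y) \<subseteq> {y. kprod x y = 0}"
    using x
    by (intro closure_cspan_subset closed_Collect_eq kprod.continuous_on continuous_intros)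
      (auto simp: csubspace_def kprod_add_right kprod_scaleC_right kprod.zero_right)
  then show ?thesis using y by blast
qed

locale J_orthogonal_frame_basis =
  fixes F :: "nat \<Rightarrow> 'a::krein_space"
  assumes J_orthogonal: "J_orthogonal F"
    and basis: "schauder_basis F"
    and frame: "J_frame F"
begin

abbreviation "ecoeff f n \<equiv> kprod f (F n) / kprod (F n) (F n)"

section \<open>The two definite subspaces and the expansion coefficients\<close>

lemma M_plus_pos: "p \<in> M_plus F \<Longrightarrow> p \<noteq> 0 \<Longrightarrow> 0 < Re (kprod p p)"
  and M_minus_neg: "m \<in> M_minus F \<Longrightarrow> m \<noteq> 0 \<Longrightarrow> Re (kprod m m) < 0"
  and csubspace_M_plus: "csubspace (M_plus F)"
  and csubspace_M_minus: "csubspace (M_minus F)"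
  and closed_M_plus: "closed (M_plus F)"
  and closed_M_minus: "closed (M_minus F)"
  using frame unfolding J_frame_def maximal_positive_def maximal_negative_def
    positive_subspace_def negative_subspace_def by blast+

lemma M_plus_nonneg: "p \<in> M_plus F \<Longrightarrow> 0 \<le> Re (kprod p p)"
  using M_plus_pos[of p] by (cases "p = 0") auto

lemma M_minus_nonpos: "m \<in> M_minus F \<Longrightarrow> Re (kprod m m) \<le> 0"
  using M_minus_neg[of m] by (cases "m = 0") auto

lemma F_in_M_plus: "n \<in> N_plus F \<Longrightarrow> F n \<in> M_plus F"
  unfolding M_plus_def by (rule closure_cspan_superset[THEN subsetD]) simp

lemma F_in_M_minus: "n \<in> N_minus F \<Longrightarrow> F n \<in> M_minus F"
  unfolding M_minus_def by (rule closure_cspan_superset[THEN subsetD]) simp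

lemma N_minus_eq: "N_minus F = - N_plus F"
  by (auto simp: N_plus_def N_minus_def)

lemma kprod_F: "n \<noteq> k \<Longrightarrow> kprod (F n) (F k) = 0"
  using J_orthogonal by (simp add: J_orthogonal_def)

lemma M_plus_M_minus_orthogonal:
  assumes "p \<in> M_plus F" "m \<in> M_minus F"
  shows "kprod p m = 0"
  using assms unfolding M_plus_def M_minus_def N_minus_eq
  by (rule kprod_closure_cspan_eq_0[rotated]) (auto intro!: kprod_F)

text \<open>If \<open>F n = 0\<close>, the coefficient at \<open>n\<close> is arbitrary, so
  \<open>0\<close> has two expansions.\<close>

lemma F_nonzero: "F n \<noteq> 0"
proof
  assume "F n = 0"
  obtain c0 where c0: "\<And>c. (\<lambda>k. c k *\<^sub>C F k) sums 0 \<Longrightarrow> c = c0"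
    using basis[unfolded schauder_basis_def, rule_format, of 0] by (rule ex1E) (rule that, simp)
  have "(\<lambda>k. (if k = n then 1 else 0) *\<^sub>C F k) = (\<lambda>k. 0)" using \<open>F n = 0\<close> by auto
  then have "(\<lambda>k. (if k = n then 1 else 0) *\<^sub>C F k) sums 0" by (simp only: sums_zero)
  then have "(\<lambda>k. if k = n then 1 else 0) = c0" by (rule c0)
  moreover have "(\<lambda>k. 0 *\<^sub>C F k) sums 0" by simp
  then have "(\<lambda>k. 0) = c0" by (rule c0)
  ultimately have "(\<lambda>k. if k = n then 1 else 0) = (\<lambda>k. 0 :: complex)" by simp
  then show False by (auto dest: fun_cong[of _ _ n])
qed

text \<open>On \<open>N_plus F\<close> the value \<open>0\<close> is excluded because the positive
  subspace \<open>M_plus F\<close> contains the nonzero vector \<open>F n\<close>.\<close>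

lemma kprod_F_self_nonzero: "kprod (F n) (F n) \<noteq> 0"
proof (cases "n \<in> N_plus F")
  case True
  then show ?thesis using M_plus_pos[OF F_in_M_plus F_nonzero] by fastforce
next
  case False
  then show ?thesis by (auto simp: N_plus_def)
qed

text \<open>Pairing the basis expansion termwise with \<open>F k\<close> leaves, by orthogonality,
  only the coefficient at \<open>k\<close>.\<close>

lemma expansion: "(\<lambda>n. ecoeff f n *\<^sub>C F n) sums f"
proof -
  obtain c where c: "(\<lambda>n. c n *\<^sub>C F n) sums f" using basis unfolding schauder_basis_def by blast
  have "c k = ecoeff f k" for k
  proof -
    have "(\<lambda>n. kprod (c n *\<^sub>C F n) (F k)) sums kprod f (F k)"
      using kprod.bounded_linear_left c by (rule bounded_linear.sums)
    moreover have "(\<lambda>n. kprod (c n *\<^sub>C F n) (F k)) = (\<lambda>n. if n = k then c n * kprod (F n) (F n) else 0)"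
      using kprod_F by (auto simp: kprod_scaleC_left)
    ultimately have "kprod f (F k) = c k * kprod (F k) (F k)"
      using sums_single[of k "\<lambda>n. c n * kprod (F n) (F n)"] sums_unique2 by metis
    then show ?thesis using kprod_F_self_nonzero by simp
  qed
  then show ?thesis using c by simp
qed

text \<open>For \<open>f = F n\<close> the frame sum collapses to one term, the square of
  \<open>cmod (kprod (F n) (F n))\<close>; one factor cancels.\<close>

lemma frame_bounds_F: "\<exists>A>0. \<exists>B. \<forall>n. A \<le> cmod (kprod (F n) (F n)) \<and> cmod (kprod (F n) (F n)) \<le> B"
proof -
  obtain A B where AB: "0 < A" "A \<le> B" "frame_bounds A B F (N_plus F) (cspan (F ` N_plus F))"
      "frame_bounds A B F (N_minus F) (cspan (F ` N_minus F))"
    using frame unfolding J_frame_def by blast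
  have "A \<le> cmod (kprod (F n) (F n)) \<and> cmod (kprod (F n) (F n)) \<le> B" for n
  proof -
    obtain N where N: "n \<in> N" "frame_bounds A B F N (cspan (F ` N))"
      using AB N_minus_eq by blast
    let ?s = "cmod (kprod (F n) (F n))"
    have "F n \<in> cspan (F ` N)" using N(1) by (intro complex_vector.span_base) simp
    moreover have "(\<Sum>\<^sub>\<infinity>k\<in>N. (cmod (kprod (F n) (F k)))\<^sup>2) = ?s\<^sup>2"
    proof -
      have "(\<Sum>\<^sub>\<infinity>k\<in>N. (cmod (kprod (F n) (F k)))\<^sup>2) = (\<Sum>\<^sub>\<infinity>k\<in>{n}. (cmod (kprod (F n) (F k)))\<^sup>2)"
        using N(1) kprod_F by (intro infsum_cong_neutral) auto
      then show ?thesis by simp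
    qed
    ultimately have "A * ?s \<le> ?s * ?s" "?s * ?s \<le> B * ?s"
      using N(2) unfolding frame_bounds_def by (metis power2_eq_square)+
    then show ?thesis using kprod_F_self_nonzero[of n] by simp
  qed
  then show ?thesis using AB(1) by blast
qed

section \<open>Norms of the basis vectors and the summability criterion\<close>

lemma bounded_linear_coeff: "bounded_linear (\<lambda>f. ecoeff f n *\<^sub>C F n)"
proof -
  have "bounded_linear (\<lambda>f. kprod f (F n) * (1 / kprod (F n) (F n)))"
    by (rule bounded_linear_mult_const[OF kprod.bounded_linear_left])
  then show ?thesis
    using scaleC.bounded_linear_left bounded_linear_compose by fastforce
qed

text \<open>
  The terms of a convergent series are bounded, so the maps \<open>f \<mapsto> ecoeff f n *\<^sub>C F n\<close> are uniformly
  bounded; at \<open>fund_sym (F n)\<close> their norm is \<open>(norm (F n))\<^sup>3 / \<bar>[F n, F n]\<bar>\<close>.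
\<close>

lemma norm_F_bounded: "\<exists>C>0. \<forall>n. norm (F n) \<le> C"
proof -
  have "\<exists>b. \<forall>n\<in>UNIV. norm (ecoeff f n *\<^sub>C F n) \<le> b" for f
    using summable_imp_Bseq[OF sums_summable[OF expansion[of f]]] unfolding Bseq_def by auto
  then obtain K where K: "0 \<le> K" "\<And>n f. norm (ecoeff f n *\<^sub>C F n) \<le> K * norm f"
    using uniform_boundedness[of UNIV UNIV "\<lambda>n f. ecoeff f n *\<^sub>C F n"] bounded_linear_coeff
    by (auto simp: complete_UNIV)
  obtain A B where B: "0 < A" "\<And>n. A \<le> cmod (kprod (F n) (F n))" "\<And>n. cmod (kprod (F n) (F n)) \<le> B"
    using frame_bounds_F by blast
  have "norm (F n) \<le> K * B + 1" for n
  proof -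
    let ?x = "norm (F n)" and ?s = "cmod (kprod (F n) (F n))"
    have s: "0 < ?s" using kprod_F_self_nonzero by simp
    have x: "0 < ?x" using F_nonzero by simp
    have "?x\<^sup>2 \<le> cmod (kprod (fund_sym (F n)) (F n))"
      unfolding power2_norm_eq_kprod by (rule complex_Re_le_cmod)
    then have "?x\<^sup>2 / ?s * ?x \<le> norm (ecoeff (fund_sym (F n)) n *\<^sub>C F n)"
      unfolding norm_scaleC norm_divide using s by (intro mult_right_mono divide_right_mono) auto
    also have "\<dots> \<le> K * ?x" using K(2)[of "fund_sym (F n)" n] by simp
    finally have "?x\<^sup>2 / ?s \<le> K" using x by (rule mult_right_le_imp_le)
    then have "?x\<^sup>2 \<le> K * ?s" using s by (simp add: field_simps)
    also have "\<dots> \<le> K * B" using K B by (intro mult_left_mono) auto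
    finally have "?x\<^sup>2 \<le> K * B" .
    \<comment> \<open>This turns the bound on the square into a bound on \<open>?x\<close> without
      square roots; the added \<open>1\<close> also makes the final constant positive.\<close>
    moreover have "2 * ?x \<le> ?x\<^sup>2 + 1" using zero_le_power2[of "?x - 1"] by (simp add: power2_diff)
    moreover have "0 \<le> K * B" using calculation(1) by (meson order_trans zero_le_power2)
    ultimately show ?thesis by linarith
  qed
  moreover have "0 \<le> K * B" using K B(2,3)[of 0] B(1) by (intro mult_nonneg_nonneg) auto
  ultimately show ?thesis by (intro exI[of _ "K * B + 1"]) auto
qed

text \<open>The terms of the expansion are at most \<open>C / A\<close> times
  \<open>cmod (kprod f (F n))\<close> in norm, so the series converges absolutely.\<close>

lemma summable_imp_D_un:
  assumes "summable (\<lambda>n. cmod (kprod f (F n)))"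
  shows "f \<in> D_un F"
proof -
  obtain C where C: "0 < C" "\<And>n. norm (F n) \<le> C" using norm_F_bounded by blast
  obtain A where A: "0 < A" "\<And>n. A \<le> cmod (kprod (F n) (F n))" using frame_bounds_F by blast
  have "summable (\<lambda>n. norm (ecoeff f n *\<^sub>C F n))"
  proof (rule summable_comparison_test')
    show "summable (\<lambda>n. cmod (kprod f (F n)) * (C / A))" using assms by (rule summable_mult2)
    show "norm (norm (ecoeff f n *\<^sub>C F n)) \<le> cmod (kprod f (F n)) * (C / A)" if "0 \<le> n" for n
    proof -
      have "cmod (kprod f (F n)) / cmod (kprod (F n) (F n)) * norm (F n)
          \<le> cmod (kprod f (F n)) / A * C"
        using A C by (intro mult_mono frac_le) (auto intro: order_trans)
      then show ?thesis by (simp add: norm_scaleC norm_divide)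
    qed
  qed
  then show ?thesis
    unfolding D_un_def by (simp add: summable_norm_imp_unconditionally_convergent)
qed

section \<open>Splitting of expansions and density of \<open>M_plus F + M_minus F\<close>\<close>

lemma sums_subseries_closed:
  assumes "csubspace V" "closed V" "\<And>n. n \<in> N \<Longrightarrow> F n \<in> V"
    and "(\<lambda>n. if n \<in> N then c n *\<^sub>C F n else 0) sums g"
  shows "g \<in> V"
proof (rule closed_sequentially[OF assms(2)])
  show "(\<lambda>k. \<Sum>n<k. if n \<in> N then c n *\<^sub>C F n else 0) \<longlonglongrightarrow> g"
    using assms(4) unfolding sums_def .
  show "(\<Sum>n<k. if n \<in> N then c n *\<^sub>C F n else 0) \<in> V" for k
    using assms(1,3)
    by (intro complex_vector.subspace_sum) (auto simp: csubspace_def)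
qed

text \<open>The subseries over \<open>N_plus F\<close> and \<open>N_minus F\<close> converge, have
  limits in the two closed subspaces, and add up to the expansion of \<open>f\<close>.\<close>

lemma D_un_subset: "D_un F \<subseteq> M_plus F + M_minus F"
proof
  fix f assume "f \<in> D_un F"
  then have u: "unconditionally_convergent (\<lambda>n. ecoeff f n *\<^sub>C F n)" by (simp add: D_un_def)
  obtain p where p: "(\<lambda>n. if n \<in> N_plus F then ecoeff f n *\<^sub>C F n else 0) sums p"
    using unconditionally_convergent_imp_summable_subseries[OF u] unfolding summable_def by blast
  obtain m where m: "(\<lambda>n. if n \<in> N_minus F then ecoeff f n *\<^sub>C F n else 0) sums m"
    using unconditionally_convergent_imp_summable_subseries[OF u] unfolding summable_def by blast
  have "p \<in> M_plus F"
    by (rule sums_subseries_closed[OF csubspace_M_plus closed_M_plus F_in_M_plus p])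
  moreover have "m \<in> M_minus F"
    by (rule sums_subseries_closed[OF csubspace_M_minus closed_M_minus F_in_M_minus m])
  moreover have "f = p + m"
  proof -
    have "(\<lambda>n. (if n \<in> N_plus F then ecoeff f n *\<^sub>C F n else 0) +
        (if n \<in> N_minus F then ecoeff f n *\<^sub>C F n else 0)) sums (p + m)"
      using p m by (rule sums_add)
    moreover have "(\<lambda>n. (if n \<in> N_plus F then ecoeff f n *\<^sub>C F n else 0) +
        (if n \<in> N_minus F then ecoeff f n *\<^sub>C F n else 0)) = (\<lambda>n. ecoeff f n *\<^sub>C F n)"
      by (auto simp: N_minus_eq)
    ultimately show ?thesis using expansion sums_unique2 by metis
  qed
  ultimately show "f \<in> M_plus F + M_minus F" by (auto simp: set_plus_def)
qed

text \<open>Every partial sum of an expansion splits into finite sums over \<open>N_plus F\<close>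
  and \<open>N_minus F\<close>.\<close>

lemma M_plus_M_minus_dense: "closure (M_plus F + M_minus F) = UNIV"
proof -
  have "f \<in> closure (M_plus F + M_minus F)" for f
  proof (rule closed_sequentially[OF closed_closure])
    show "(\<lambda>k. \<Sum>n<k. ecoeff f n *\<^sub>C F n) \<longlonglongrightarrow> f" using expansion unfolding sums_def .
    have "(\<Sum>n<k. ecoeff f n *\<^sub>C F n) \<in> M_plus F + M_minus F" for k
    proof -
      have "(\<Sum>n\<in>{..<k} \<inter> N_plus F. ecoeff f n *\<^sub>C F n) \<in> M_plus F"
        using csubspace_M_plus F_in_M_plus
        by (intro complex_vector.subspace_sum) (auto simp: csubspace_def)
      moreover have "(\<Sum>n\<in>{..<k} - N_plus F. ecoeff f n *\<^sub>C F n) \<in> M_minus F"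
        using csubspace_M_minus F_in_M_minus N_minus_eq
        by (intro complex_vector.subspace_sum) (auto simp: csubspace_def)
      ultimately show ?thesis
        unfolding sum.Int_Diff[OF finite_lessThan, of _ k "N_plus F"] by (rule set_plus_intro)
    qed
    then show "(\<Sum>n<k. ecoeff f n *\<^sub>C F n) \<in> closure (M_plus F + M_minus F)" for k
      using closure_subset by blast
  qed
  then show ?thesis by blast
qed

text \<open>If \<open>p n + m n\<close> tends to \<open>f\<close>, the bound makes \<open>p\<close>
  a Cauchy sequence; its limit and the remainder of \<open>f\<close> lie in the closed subspaces.
  Both strictness arguments end here.\<close>

lemma plus_eq_UNIV_if_projection_bounded:
  assumes K: "\<And>p m. p \<in> M_plus F \<Longrightarrow> m \<in> M_minus F \<Longrightarrow> norm p \<le> K * norm (p + m)"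
  shows "M_plus F + M_minus F = UNIV"
proof -
  have "f \<in> M_plus F + M_minus F" for f
  proof -
    obtain g where g: "\<forall>n. g n \<in> M_plus F + M_minus F" "g \<longlonglongrightarrow> f"
      using M_plus_M_minus_dense closure_sequential[of f "M_plus F + M_minus F"] by auto
    then obtain p m where pm: "\<And>n. p n \<in> M_plus F" "\<And>n. m n \<in> M_minus F" "\<And>n. g n = p n + m n"
      unfolding set_plus_def by (simp, metis)
    have K0: "norm (p i - p j) \<le> \<bar>K\<bar> * norm (g i - g j)" for i j
    proof -
      have "norm (p i - p j) \<le> K * norm ((p i - p j) + (m i - m j))"
        using pm csubspace_M_plus csubspace_M_minus by (intro K complex_vector.subspace_diff) auto
      also have "\<dots> \<le> \<bar>K\<bar> * norm (g i - g j)"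
        unfolding pm(3) by (simp add: add_diff_add mult_right_mono)
      finally show ?thesis .
    qed
    have "Cauchy p"
    proof (rule CauchyI)
      fix e :: real assume "0 < e"
      \<comment> \<open>The summand \<open>1\<close> keeps the denominator positive even for
        \<open>K = 0\<close>.\<close>
      then have "0 < e / (\<bar>K\<bar> + 1)" by (intro divide_pos_pos) auto
      then obtain N where N: "\<And>i j. N \<le> i \<Longrightarrow> N \<le> j \<Longrightarrow> norm (g i - g j) < e / (\<bar>K\<bar> + 1)"
        using LIMSEQ_imp_Cauchy[OF g(2)] unfolding Cauchy_iff by blast
      have "norm (p i - p j) < e" if "N \<le> i" "N \<le> j" for i j
      proof -
        have "norm (p i - p j) \<le> (\<bar>K\<bar> + 1) * norm (g i - g j)"
          using K0[of i j] norm_ge_zero[of "g i - g j"] unfolding distrib_right by linarith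
        also have "\<dots> < (\<bar>K\<bar> + 1) * (e / (\<bar>K\<bar> + 1))"
          using N[OF that] by (intro mult_strict_left_mono) auto
        finally show ?thesis by simp
      qed
      then show "\<exists>M. \<forall>i\<ge>M. \<forall>j\<ge>M. norm (p i - p j) < e" by blast
    qed
    then obtain l where l: "p \<longlonglongrightarrow> l" using Cauchy_convergent convergent_def by blast
    have "l \<in> M_plus F" by (rule closed_sequentially[OF closed_M_plus _ l]) (rule pm)
    moreover have "(\<lambda>n. g n - p n) \<longlonglongrightarrow> f - l" using g(2) l by (rule tendsto_diff)
    then have "f - l \<in> M_minus F"
      by (rule closed_sequentially[OF closed_M_minus, rotated]) (simp add: pm)
    ultimately have "l + (f - l) \<in> M_plus F + M_minus F" by (rule set_plus_intro)
    then show ?thesis by simp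
  qed
  then show ?thesis by blast
qed

end

section \<open>Completion with respect to an unbounded form\<close>

lemma real_form_sqrt_triangle:
  fixes b :: "'a::real_vector \<Rightarrow> 'a \<Rightarrow> real"
  assumes V: "subspace V"
    and add: "\<And>x y z. x \<in> V \<Longrightarrow> y \<in> V \<Longrightarrow> z \<in> V \<Longrightarrow> b (x + y) z = b x z + b y z"
    and scale: "\<And>r x z. x \<in> V \<Longrightarrow> z \<in> V \<Longrightarrow> b (r *\<^sub>R x) z = r * b x z"
    and sym: "\<And>x y. x \<in> V \<Longrightarrow> y \<in> V \<Longrightarrow> b x y = b y x"
    and pos: "\<And>x. x \<in> V \<Longrightarrow> 0 \<le> b x x"
    and x: "x \<in> V" and y: "y \<in> V"
  shows "sqrt (b (x + y) (x + y)) \<le> sqrt (b x x) + sqrt (b y y)"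
proof (rule real_le_lsqrt)
  have xy: "x + y \<in> V" using V x y by (rule subspace_add)
  have "(b x y)\<^sup>2 \<le> b x x * b y y"
    using V add scale sym pos x y by (rule real_form_Cauchy_Schwarz)
  then have "(b x y)\<^sup>2 \<le> (sqrt (b x x) * sqrt (b y y))\<^sup>2"
    using pos x y by (simp add: power_mult_distrib)
  then have "b x y \<le> sqrt (b x x) * sqrt (b y y)"
    by (rule power2_le_imp_le) (simp add: pos x y)
  moreover have "b (x + y) (x + y) = b x x + 2 * b x y + b y y"
    using add[OF x y xy] sym[OF x xy] sym[OF y xy] add[OF x y x] add[OF x y y] sym[OF x y] by simp
  ultimately show "b (x + y) (x + y) \<le> (sqrt (b x x) + sqrt (b y y))\<^sup>2"
    using pos x y by (simp add: power2_sum)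
qed (simp add: pos x y)

text \<open>
  The limit is \<open>f = \<Sum>k. (1/2) ^ k / E k *\<^sub>R u k\<close> with unit vectors \<open>u k \<in> D\<close> whose form norms \<open>E k\<close>
  grow so fast that \<open>b f (u j)\<close> would be at least \<open>j - 1\<close>; but \<open>b f\<close> would be bounded if \<open>f \<in> D\<close>.
\<close>

lemma unbounded_form_limit_outside:
  fixes b :: "'a::banach \<Rightarrow> 'a \<Rightarrow> real"
  assumes D: "subspace D"
    and add: "\<And>x y z. x \<in> D \<Longrightarrow> y \<in> D \<Longrightarrow> z \<in> D \<Longrightarrow> b (x + y) z = b x z + b y z"
    and scale: "\<And>r x z. x \<in> D \<Longrightarrow> z \<in> D \<Longrightarrow> b (r *\<^sub>R x) z = r * b x z"
    and sym: "\<And>x y. x \<in> D \<Longrightarrow> y \<in> D \<Longrightarrow> b x y = b y x"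
    and ge: "\<And>x. x \<in> D \<Longrightarrow> (norm x)\<^sup>2 \<le> b x x"
    and bdd: "\<And>x. x \<in> D \<Longrightarrow> \<exists>C. \<forall>y\<in>D. \<bar>b x y\<bar> \<le> C * norm y"
    and unbdd: "\<And>M. \<exists>x\<in>D. M * (norm x)\<^sup>2 < b x x"
  obtains f g where "f \<notin> D" "\<And>n. g n \<in> D" "g \<longlonglongrightarrow> f"
    "\<And>e. 0 < e \<Longrightarrow> \<exists>N. \<forall>m\<ge>N. \<forall>n\<ge>N. sqrt (b (g m - g n) (g m - g n)) < e"
proof -
  have pos: "0 \<le> b x x" if "x \<in> D" for x using ge[OF that] by (meson order_trans zero_le_power2)
  have diff_right: "b x (y - z) = b x y - b x z" if "x \<in> D" "y \<in> D" "z \<in> D" for x y z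
  proof -
    have yz: "y - z \<in> D" using D that by (intro subspace_diff)
    show ?thesis using add[OF yz that(3,1)] sym that yz by simp
  qed
  have scale_right: "b x (r *\<^sub>R y) = r * b x y" if "x \<in> D" "y \<in> D" for r x y
    using scale[OF that(2,1)] sym that D by (simp add: subspace_scale)
  have "\<exists>C\<ge>0. \<forall>y\<in>D. \<bar>b x y\<bar> \<le> C * norm y" if x: "x \<in> D" for x
  proof -
    obtain C where C: "\<forall>y\<in>D. \<bar>b x y\<bar> \<le> C * norm y" using bdd[OF x] by blast
    have "\<bar>b x y\<bar> \<le> \<bar>C\<bar> * norm y" if "y \<in> D" for y
      using C that by (meson abs_ge_self mult_right_mono norm_ge_zero order_trans)
    then show ?thesis by (intro exI[of _ "\<bar>C\<bar>"]) auto
  qed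
  then obtain B where B: "\<And>x. x \<in> D \<Longrightarrow> 0 \<le> B x" "\<And>x y. x \<in> D \<Longrightarrow> y \<in> D \<Longrightarrow> \<bar>b x y\<bar> \<le> B x * norm y"
    by metis
  have unit: "\<exists>x\<in>D. norm x = 1 \<and> M \<le> sqrt (b x x)" for M
  proof -
    obtain x where x: "x \<in> D" "M\<^sup>2 * (norm x)\<^sup>2 < b x x" using unbdd by blast
    have "x \<noteq> 0" using x scale[of x x 0] by auto
    let ?y = "(1 / norm x) *\<^sub>R x"
    have "b ?y ?y = b x x / (norm x)\<^sup>2"
      using x scale scale_right D by (simp add: subspace_scale power2_eq_square)
    moreover have "M\<^sup>2 < b x x / (norm x)\<^sup>2" using x \<open>x \<noteq> 0\<close> by (simp add: pos_less_divide_eq)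
    ultimately have "M \<le> sqrt (b ?y ?y)" by (simp add: real_le_rsqrt)
    then show ?thesis using x \<open>x \<noteq> 0\<close> D by (intro bexI[of _ ?y]) (auto simp: subspace_scale)
  qed
  \<comment> \<open>\<open>s\<close> accumulates the bounds \<open>B\<close> of the vectors chosen
    before; the next form norm must dominate all of them.\<close>
  define P where "P = (\<lambda>(k::nat) (x, s::real). x \<in> D \<and> norm x = 1 \<and> 0 \<le> s \<and>
      2 ^ k * (real k + 1 + s) \<le> sqrt (b x x))"
  have "\<exists>h. \<forall>k. P k (h k) \<and> snd (h (Suc k)) = snd (h k) + B (fst (h k))"
  proof (rule dependent_nat_choice)
    obtain x where "x \<in> D" "norm x = 1" "1 \<le> sqrt (b x x)" using unit by blast
    then have "P 0 (x, 0)" by (simp add: P_def)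
    then show "\<exists>h. P 0 h" ..
  next
    fix h k assume h: "P k h"
    define s where "s = snd h + B (fst h)"
    have "0 \<le> s" using h B(1) by (auto simp: P_def s_def split: prod.splits)
    moreover obtain x where "x \<in> D" "norm x = 1" "2 ^ Suc k * (real (Suc k) + 1 + s) \<le> sqrt (b x x)"
      using unit by blast
    ultimately have "P (Suc k) (x, s)" by (simp add: P_def)
    then show "\<exists>h'. P (Suc k) h' \<and> snd h' = snd h + B (fst h)"
      by (intro exI[of _ "(x, s)"]) (simp add: s_def)
  qed
  then obtain h where h: "\<And>k. P k (h k)" "\<And>k. snd (h (Suc k)) = snd (h k) + B (fst (h k))"
    by blast
  define u where "u k = fst (h k)" for k
  define s where "s k = snd (h k)" for k
  define E where "E k = sqrt (b (u k) (u k))" for k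
  have u: "u k \<in> D" "norm (u k) = 1" "0 \<le> s k" "2 ^ k * (real k + 1 + s k) \<le> E k"
    "s (Suc k) = s k + B (u k)" for k
    using h(1)[of k] h(2)[of k] by (auto simp: P_def u_def s_def E_def split: prod.splits)
  have Es: "real k + 1 + s k \<le> E k" for k
  proof -
    have "1 * (real k + 1 + s k) \<le> 2 ^ k * (real k + 1 + s k)"
      using u(3)[of k] by (intro mult_right_mono) auto
    then show ?thesis using u(4)[of k] by simp
  qed
  have E1: "1 \<le> E k" for k using Es[of k] u(3)[of k] by simp
  have smono: "s i \<le> s j" if "i \<le> j" for i j
    using _ that by (rule lift_Suc_mono_le[of s]) (simp add: u(5) B(1)[OF u(1)])
  have sB: "B (u i) \<le> s j" if "i < j" for i j
    using smono[of "Suc i" j] that u(3,5)[of i] by simp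
  have sumB: "(\<Sum>k<j. B (u k)) \<le> s j" for j
    by (induction j) (use u(3)[of 0] u(5) in auto)
  \<comment> \<open>With this factor \<open>v k\<close> has form norm exactly
    \<open>(1/2) ^ k\<close>.\<close>
  define a where "a k = (1/2) ^ k / E k" for k
  define v where "v k = a k *\<^sub>R u k" for k
  have a: "0 < a k" "a k \<le> (1/2) ^ k" "a k \<le> 1" for k
  proof -
    show "0 < a k" using E1[of k] by (simp add: a_def)
    show "a k \<le> (1/2) ^ k"
      using E1[of k] divide_left_mono[of 1 "E k" "(1/2) ^ k"] by (simp add: a_def)
    also have "\<dots> \<le> 1" by (simp add: power_le_one)
    finally show "a k \<le> 1" .
  qed
  have vD: "v k \<in> D" for k using u D by (simp add: v_def subspace_scale)
  have bvv: "sqrt (b (v k) (v k)) = (1/2) ^ k" for k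
  proof -
    have "b (v k) (v k) = (a k)\<^sup>2 * b (u k) (u k)"
      using u(1) scale scale_right D by (simp add: v_def subspace_scale power2_eq_square)
    then have "sqrt (b (v k) (v k)) = a k * E k"
      using a(1)[of k] by (simp add: real_sqrt_mult E_def)
    then show ?thesis using E1[of k] by (simp add: a_def)
  qed
  define g where "g n = (\<Sum>k<n. v k)" for n
  have gD: "g n \<in> D" for n using vD D by (simp add: g_def subspace_sum)
  have "summable v"
  proof (rule summable_comparison_test')
    show "summable (\<lambda>k. (1/2 :: real) ^ k)" by (simp add: summable_geometric)
    show "norm (v k) \<le> (1/2) ^ k" if "0 \<le> k" for k using a(1,2)[of k] u(2)[of k] by (simp add: v_def)
  qed
  then have lim: "g \<longlonglongrightarrow> suminf v" unfolding g_def by (rule summable_LIMSEQ)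
  \<comment> \<open>The right-hand side is the geometric sum of \<open>(1/2) ^ k\<close> over
    \<open>n \<le> k < m\<close>.\<close>
  have tail: "sqrt (b (g m - g n) (g m - g n)) \<le> 2 * (1/2) ^ n - 2 * (1/2) ^ m" if "n \<le> m" for m n
    using that
  proof (induction m rule: dec_induct)
    case base
    then show ?case using scale[OF D[THEN subspace_0] D[THEN subspace_0], of 0] by simp
  next
    case (step m)
    have eq: "g (Suc m) - g n = (g m - g n) + v m" by (simp add: g_def)
    have "sqrt (b (g (Suc m) - g n) (g (Suc m) - g n))
        \<le> sqrt (b (g m - g n) (g m - g n)) + sqrt (b (v m) (v m))"
      unfolding eq by (rule real_form_sqrt_triangle[OF D add scale sym pos subspace_diff[OF D gD gD] vD])
    then show ?case using step.IH by (simp add: bvv)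
  qed
  have "suminf v \<notin> D"
  proof
    assume f: "suminf v \<in> D"
    have "real j - 1 \<le> B (suminf v)" for j
    proof -
      have bg: "b (u j) (g n) = (\<Sum>k<n. a k * b (u j) (u k))" for n
      proof (induction n)
        case 0
        then show ?case using scale_right[OF u(1)[of j] subspace_0[OF D], of 0] by (simp add: g_def)
      next
        case (Suc n)
        have "b (u j) (g (Suc n)) - b (u j) (g n) = b (u j) (v n)"
          using diff_right[OF u(1)[of j] gD[of "Suc n"] gD[of n]] by (simp add: g_def)
        then show ?case using Suc scale_right[OF u(1) u(1)] by (simp add: v_def)
      qed
      have lower: "real j - 1 \<le> b (u j) (g n)" if "j < n" for n
      proof -
        \<comment> \<open>Earlier vectors are controlled by their own bounds, which sum to at most
          \<open>s j\<close>; for later ones, \<open>B (u j) \<le> s k \<le> E k\<close> and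
          \<open>a k * E k = (1/2) ^ k\<close>.\<close>
        have offdiag: "\<bar>a k * b (u j) (u k)\<bar> \<le> (if k < j then B (u k) else 0) + (1/2) ^ k"
          if "k \<noteq> j" for k
        proof (cases "k < j")
          case True
          have "\<bar>b (u j) (u k)\<bar> \<le> B (u k)"
            using B(2)[OF u(1) u(1), of k j] u(2)[of j] sym[OF u(1) u(1), of j k] by simp
          then have "a k * \<bar>b (u j) (u k)\<bar> \<le> 1 * B (u k)"
            using a(1,3)[of k] by (intro mult_mono) auto
          then show ?thesis using True a(1)[of k] by (simp add: abs_mult add_increasing2)
        next
          case False
          have "\<bar>b (u j) (u k)\<bar> \<le> B (u j)"
            using B(2)[OF u(1) u(1), of j k] u(2)[of k] by simp
          also have "\<dots> \<le> E k" using sB[of j k] Es[of k] False that by simp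
          finally have "a k * \<bar>b (u j) (u k)\<bar> \<le> a k * E k"
            using a(1)[of k] by (intro mult_left_mono) auto
          then show ?thesis using False a(1)[of k] E1[of k] by (simp add: abs_mult a_def)
        qed
        have "(\<Sum>k<n. a k * b (u j) (u k)) = a j * b (u j) (u j) + (\<Sum>k\<in>{..<n} - {j}. a k * b (u j) (u k))"
          using that by (intro sum.remove) auto
        \<comment> \<open>The diagonal term \<open>E j / 2 ^ j\<close> beats the off-diagonal total
          \<open>s j + 2\<close> by \<open>j - 1\<close>.\<close>
        moreover have "a j * b (u j) (u j) \<ge> real j + 1 + s j"
        proof -
          have "b (u j) (u j) = E j * E j" using pos[OF u(1)] by (simp add: E_def)
          then have "a j * b (u j) (u j) = E j / 2 ^ j"
            using E1[of j] by (simp add: a_def power_divide)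
          then show ?thesis using u(4)[of j] by (simp add: pos_le_divide_eq mult.commute)
        qed
        moreover have "\<bar>\<Sum>k\<in>{..<n} - {j}. a k * b (u j) (u k)\<bar> \<le> s j + 2"
        proof -
          have "\<bar>\<Sum>k\<in>{..<n} - {j}. a k * b (u j) (u k)\<bar>
              \<le> (\<Sum>k\<in>{..<n} - {j}. (if k < j then B (u k) else 0) + (1/2) ^ k)"
            by (rule order_trans[OF sum_abs sum_mono]) (rule offdiag, simp)
          also have "\<dots> \<le> (\<Sum>k<n. (if k < j then B (u k) else 0) + (1/2) ^ k)"
            using B(1)[OF u(1)] by (intro sum_mono2) auto
          also have "\<dots> = (\<Sum>k<j. B (u k)) + (\<Sum>k<n. (1/2) ^ k)"
          proof -
            have "{..<n} \<inter> {k. k < j} = {..<j}" using that by auto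
            then show ?thesis by (simp add: sum.distrib sum.If_cases)
          qed
          also have "\<dots> \<le> s j + 2"
            using sumB[of j] by (intro add_mono) (simp_all add: sum_gp_strict)
          finally show ?thesis .
        qed
        ultimately show ?thesis unfolding bg by linarith
      qed
      \<comment> \<open>Norm convergence suffices here, because \<open>b (u j)\<close> is
        norm-bounded on \<open>D\<close>, which contains the limit by assumption.\<close>
      have "(\<lambda>n. b (u j) (g n)) \<longlonglongrightarrow> b (u j) (suminf v)"
      proof (rule LIM_zero_cancel, rule Lim_null_comparison)
        have "norm (b (u j) (g n) - b (u j) (suminf v)) \<le> B (u j) * norm (g n - suminf v)" for n
          using B(2)[OF u(1) subspace_diff[OF D gD f], of j n] diff_right[OF u(1) gD f] by simp
        then show "\<forall>\<^sub>F n in sequentially. norm (b (u j) (g n) - b (u j) (suminf v))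
            \<le> B (u j) * norm (g n - suminf v)" by simp
        show "(\<lambda>n. B (u j) * norm (g n - suminf v)) \<longlonglongrightarrow> 0"
          using lim by (intro tendsto_mult_right_zero tendsto_norm_zero LIM_zero)
      qed
      then have "real j - 1 \<le> b (u j) (suminf v)"
        by (rule LIMSEQ_le_const) (use lower in \<open>auto intro: exI[of _ "Suc j"]\<close>)
      also have "\<dots> \<le> B (suminf v)"
        using B(2)[OF f u(1)[of j]] u(2)[of j] sym[OF u(1) f, of j] by simp
      finally show ?thesis .
    qed
    moreover obtain j where "B (suminf v) + 1 < real j" using reals_Archimedean2 by blast
    ultimately show False by (smt (verit))
  qed
  moreover have "\<exists>N. \<forall>m\<ge>N. \<forall>n\<ge>N. sqrt (b (g m - g n) (g m - g n)) < e" if e: "0 < e" for e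
  proof -
    obtain N where N: "(1/2) ^ N < e / 2" using e real_arch_pow_inv[of "e / 2" "1/2"] by auto
    have less: "sqrt (b (g m - g n) (g m - g n)) < e" if "N \<le> n" "n \<le> m" for m n
    proof -
      have "(1/2 :: real) ^ n \<le> (1/2) ^ N" using that by (intro power_decreasing) auto
      moreover have "0 \<le> (1/2 :: real) ^ m" by simp
      ultimately show ?thesis using tail[OF that(2)] N by linarith
    qed
    have swap: "b (g m - g n) (g m - g n) = b (g n - g m) (g n - g m)" for m n
    proof -
      have "g n - g m \<in> D" by (intro subspace_diff D gD)
      then have "b ((-1) *\<^sub>R (g n - g m)) ((-1) *\<^sub>R (g n - g m)) = b (g n - g m) (g n - g m)"
        using scale scale_right D by (metis mult_minus1 mult_minus1_right minus_minus subspace_scale)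
      then show ?thesis by simp
    qed
    have "sqrt (b (g m - g n) (g m - g n)) < e" if "N \<le> n" "N \<le> m" for m n
      using less[of n m] less[of m n] that swap[of m n] by (cases "n \<le> m") auto
    then show ?thesis by blast
  qed
  ultimately show thesis using that gD lim by blast
qed

section \<open>The inclusions\<close>

context J_orthogonal_frame_basis
begin

lemma csubspace_sum: "csubspace (M_plus F + M_minus F)"
  unfolding set_plus_def
  using complex_vector.subspace_sums[OF csubspace_M_plus csubspace_M_minus] by (simp add: Bex_def conj_ac)

text \<open>The operators \<open>L S\<close> have a common bound \<open>K\<close> on
  \<open>M_plus F\<close>. For a partial sum \<open>g k\<close> of the expansion of
  \<open>p\<close>, suitable signs give \<open>h\<close> with \<open>(norm h)\<^sup>2 \<le>
  C\<^sup>2 / A * Re (kprod (g k) (g k))\<close>; undoing the signs costs a factor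
  \<open>2 * K\<close>, and \<open>k\<close> tends to infinity.\<close>

lemma M_plus_norm_le_if_subset_D_un:
  assumes sub: "M_plus F \<subseteq> D_un F"
  shows "\<exists>K. \<forall>p\<in>M_plus F. (norm p)\<^sup>2 \<le> K * Re (kprod p p)"
proof -
  obtain C where C: "0 < C" "\<And>n. norm (F n) \<le> C" using norm_F_bounded by blast
  obtain A where A: "0 < A" "\<And>n. A \<le> cmod (kprod (F n) (F n))" using frame_bounds_F by blast
  define L where "L S f = (\<Sum>n\<in>S. ecoeff f n *\<^sub>C F n)" for S f
  have "\<exists>b. \<forall>S\<in>Collect finite. norm (L S f) \<le> b" if "f \<in> M_plus F" for f
    using unconditionally_convergent_imp_bounded_sums[of "\<lambda>n. ecoeff f n *\<^sub>C F n"] sub that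
    by (auto simp: D_un_def L_def)
  moreover have "bounded_linear (L S)" for S
    unfolding L_def by (intro bounded_linear_sum bounded_linear_coeff)
  moreover have "complete (M_plus F)" using closed_M_plus complete_eq_closed by blast
  ultimately obtain K where K: "0 \<le> K"
    "\<And>S f. finite S \<Longrightarrow> f \<in> M_plus F \<Longrightarrow> norm (L S f) \<le> K * norm f"
    using uniform_boundedness[of "M_plus F" "Collect finite" L]
      csubspace_imp_subspace[OF csubspace_M_plus] by auto
  have "(norm p)\<^sup>2 \<le> 4 * K\<^sup>2 * C\<^sup>2 / A * Re (kprod p p)" if p: "p \<in> M_plus F" for p
  proof -
    define v where "v n = ecoeff p n *\<^sub>C F n" for n
    define g where "g k = (\<Sum>n<k. v n)" for k
    have lim: "g \<longlonglongrightarrow> p" using expansion[of p] unfolding sums_def g_def v_def .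
    have c0: "ecoeff p n = 0" if "n \<notin> N_plus F" for n
      using M_plus_M_minus_orthogonal[OF p F_in_M_minus] that by (simp add: N_minus_eq)
    have v: "v n \<in> M_plus F" for n
      using c0[of n] F_in_M_plus[of n] csubspace_M_plus by (cases "n \<in> N_plus F") (auto simp: v_def csubspace_def)
    have "(norm (g k))\<^sup>2 \<le> 4 * K\<^sup>2 * C\<^sup>2 / A * Re (kprod (g k) (g k))" for k
    proof -
      obtain T where T: "T \<subseteq> {..<k}"
        "(norm (sum v T - sum v ({..<k} - T)))\<^sup>2 \<le> (\<Sum>n<k. (norm (v n))\<^sup>2)"
        using exists_signs_norm_sum_le[of "{..<k}" v] by auto
      define h where "h = sum v T - sum v ({..<k} - T)"
      have finT: "finite T" using T(1) finite_subset by blast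
      have h: "h \<in> M_plus F"
        unfolding h_def
        by (intro complex_vector.subspace_diff complex_vector.subspace_sum csubspace_M_plus v)
      have kv: "kprod (sum v S) (F n) = (if n \<in> S then kprod p (F n) else 0)" if "finite S" for S n
      proof -
        have "kprod (sum v S) (F n) = (\<Sum>i\<in>S. kprod (v i) (F n))" by (rule kprod.sum_left)
        also have "\<dots> = (\<Sum>i\<in>S. if i = n then kprod p (F n) else 0)"
          using kprod_F kprod_F_self_nonzero by (intro sum.cong) (auto simp: v_def kprod_scaleC_left)
        finally show ?thesis using that by simp
      qed
      \<comment> \<open>\<open>L T\<close> and \<open>L ({..<k} - T)\<close> pick out the terms of
        \<open>h\<close> with sign \<open>+\<close> and \<open>-\<close>; their difference restores
        \<open>g k\<close>.\<close>
      have "L T h = sum v T" "L ({..<k} - T) h = - sum v ({..<k} - T)"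
        using kv[OF finT] kv[of "{..<k} - T"] unfolding L_def h_def sum_negf[symmetric]
        by (auto intro!: sum.cong simp: v_def kprod.diff_left complex_vector.scale_minus_left)
      then have "g k = L T h - L ({..<k} - T) h"
        using sum.subset_diff[OF T(1), of v] by (simp add: g_def)
      then have "norm (g k) \<le> norm (L T h) + norm (L ({..<k} - T) h)" using norm_triangle_ineq4 by simp
      also have "\<dots> \<le> 2 * K * norm h" using K(2)[OF finT h] K(2)[OF _ h, of "{..<k} - T"] by simp
      finally have "(norm (g k))\<^sup>2 \<le> (2 * K * norm h)\<^sup>2" by (intro power_mono) auto
      also have "\<dots> = 4 * K\<^sup>2 * (norm h)\<^sup>2" by (simp add: power_mult_distrib)
      also have "\<dots> \<le> 4 * K\<^sup>2 * (C\<^sup>2 / A * Re (kprod (g k) (g k)))"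
      proof (rule mult_left_mono)
        have "(norm (v n))\<^sup>2 \<le> C\<^sup>2 / A * Re (kprod (v n) (v n))" for n
        proof (cases "n \<in> N_plus F")
          case True
          let ?c = "cmod (ecoeff p n)" and ?s = "Re (kprod (F n) (F n))"
          have s: "cmod (kprod (F n) (F n)) = ?s"
            using True by (simp add: N_plus_def cmod_def)
          have "kprod (v n) (v n) = complex_of_real (?c\<^sup>2) * kprod (F n) (F n)"
            unfolding v_def kprod_scaleC_left kprod_scaleC_right complex_norm_square
            by (simp only: mult.assoc mult.left_commute)
          then have "Re (kprod (v n) (v n)) = ?c\<^sup>2 * ?s" by simp
          moreover have "(norm (v n))\<^sup>2 = ?c\<^sup>2 * (norm (F n))\<^sup>2"
            by (simp add: v_def norm_scaleC power_mult_distrib)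
          moreover have "(norm (F n))\<^sup>2 \<le> C\<^sup>2" using C by (intro power_mono) auto
          \<comment> \<open>The lower bound \<open>A \<le> ?s\<close> trades the Hilbert norm for
            the indefinite form.\<close>
          moreover have "C\<^sup>2 \<le> C\<^sup>2 / A * ?s"
            using A(1) A(2)[of n] mult_left_mono[of A ?s "C\<^sup>2"] by (simp add: s pos_le_divide_eq)
          ultimately show ?thesis
            using mult_left_mono[of "(norm (F n))\<^sup>2" "C\<^sup>2 / A * ?s" "?c\<^sup>2"] by (simp add: mult_ac)
        next
          case False
          then have "v n = 0" unfolding v_def c0[OF False] by simp
          then show ?thesis by simp
        qed
        then have "(\<Sum>n<k. (norm (v n))\<^sup>2) \<le> C\<^sup>2 / A * (\<Sum>n<k. Re (kprod (v n) (v n)))"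
          unfolding sum_distrib_left by (intro sum_mono)
        also have "(\<Sum>n<k. Re (kprod (v n) (v n))) = Re (kprod (g k) (g k))"
        proof -
          have "kprod (v n) (g k) = kprod (v n) (v n)" if "n < k" for n
          proof -
            have "kprod (v n) (g k) = (\<Sum>i<k. kprod (v n) (v i))"
              unfolding g_def by (rule kprod.sum_right)
            also have "\<dots> = (\<Sum>i<k. if i = n then kprod (v n) (v n) else 0)"
              using kprod_F by (intro sum.cong) (auto simp: v_def kprod_scaleC_left kprod_scaleC_right)
            finally show ?thesis using that by simp
          qed
          then have "kprod (g k) (g k) = (\<Sum>n<k. kprod (v n) (v n))"
            by (subst (1) g_def) (simp add: kprod.sum_left)
          then show ?thesis by (simp add: Re_sum)
        qed
        finally show "(norm h)\<^sup>2 \<le> C\<^sup>2 / A * Re (kprod (g k) (g k))" using T(2) by (simp add: h_def)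
      qed simp
      finally show ?thesis by (simp add: mult_ac)
    qed
    then show ?thesis
      using A(1)
      by (intro LIMSEQ_le[of "\<lambda>k. (norm (g k))\<^sup>2" _ "\<lambda>k. 4 * K\<^sup>2 * C\<^sup>2 / A * Re (kprod (g k) (g k))"])
        (auto intro!: tendsto_intros kprod.tendsto lim)
  qed
  then show ?thesis by blast
qed

lemma D_un_psubset:
  assumes "M_plus F + M_minus F \<noteq> UNIV"
  shows "D_un F \<subset> M_plus F + M_minus F"
proof -
  have "M_plus F + M_minus F = UNIV" if sub: "M_plus F + M_minus F \<subseteq> D_un F"
  proof -
    have "p + 0 \<in> D_un F" if "p \<in> M_plus F" for p
      using sub set_plus_intro[OF that] csubspace_M_minus unfolding csubspace_def by blast
    then have "M_plus F \<subseteq> D_un F" by auto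
    then obtain K where K: "\<And>p. p \<in> M_plus F \<Longrightarrow> (norm p)\<^sup>2 \<le> K * Re (kprod p p)"
      using M_plus_norm_le_if_subset_D_un by blast
    show ?thesis
    proof (rule plus_eq_UNIV_if_projection_bounded)
      fix p m assume p: "p \<in> M_plus F" and m: "m \<in> M_minus F"
      have "kprod m p = 0"
        using M_plus_M_minus_orthogonal[OF p m] by (subst kprod_commute) simp
      \<comment> \<open>Orthogonality puts \<open>p + m\<close> into one argument, so that one
        factor \<open>norm p\<close> cancels below.\<close>
      then have eq: "Re (kprod p p) = Re (kprod (p + m) p)" by (simp add: kprod_add_left)
      have "(norm p)\<^sup>2 \<le> \<bar>K\<bar> * Re (kprod p p)"
        using K[OF p] M_plus_nonneg[OF p] by (meson abs_ge_self mult_right_mono order_trans)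
      also have "\<dots> \<le> \<bar>K\<bar> * (norm (p + m) * norm p)"
        unfolding eq
        using order_trans[OF complex_Re_le_cmod norm_kprod_le] by (intro mult_left_mono) auto
      finally have "norm p * norm p \<le> \<bar>K\<bar> * norm (p + m) * norm p"
        by (simp add: power2_eq_square mult_ac)
      then show "norm p \<le> \<bar>K\<bar> * norm (p + m)"
        by (cases "p = 0") (auto intro: mult_right_le_imp_le)
    qed
  qed
  then show ?thesis using D_un_subset assms by blast
qed

text \<open>The real part of the polarised squared energetic norm: as \<open>fund_sym\<close> is an
  involution, \<open>hprod (exp_Q F f) g\<close> equals \<open>kprod (J_M F f) g\<close>.\<close>

definition energetic_form :: "'a \<Rightarrow> 'a \<Rightarrow> real" where
  "energetic_form f g = Re (kprod (fund_sym f) g) + Re (kprod (J_M F f) g)"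

lemma energetic_norm_eq: "energetic_norm F f = sqrt (energetic_form f f)"
  unfolding energetic_norm_def energetic_form_def exp_Q_def hprod_def
  by (simp add: power2_norm_eq_kprod)

section \<open>Linearity, symmetry and positivity of \<open>J_M\<close> on its domain\<close>

lemma J_M_decomp:
  assumes "f \<in> M_plus F + M_minus F"
  obtains p m where "p \<in> M_plus F" "m \<in> M_minus F" "f = p + m" "J_M F f = p - m"
  using assms J_M_eq[OF frame] by (metis set_plus_elim)

lemma J_M_add:
  assumes "f \<in> M_plus F + M_minus F" "g \<in> M_plus F + M_minus F"
  shows "J_M F (f + g) = J_M F f + J_M F g"
proof -
  obtain p m where f: "p \<in> M_plus F" "m \<in> M_minus F" "f = p + m" "J_M F f = p - m"
    by (rule J_M_decomp[OF assms(1)])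
  obtain q n where g: "q \<in> M_plus F" "n \<in> M_minus F" "g = q + n" "J_M F g = q - n"
    by (rule J_M_decomp[OF assms(2)])
  have "J_M F ((p + q) + (m + n)) = (p + q) - (m + n)"
    using f g csubspace_M_plus csubspace_M_minus
    by (intro J_M_eq frame) (auto simp: csubspace_def)
  moreover have "f + g = (p + q) + (m + n)" by (simp add: f(3) g(3))
  ultimately show ?thesis unfolding f(4) g(4) by simp
qed

lemma J_M_scaleR:
  assumes "f \<in> M_plus F + M_minus F"
  shows "J_M F (r *\<^sub>R f) = r *\<^sub>R J_M F f"
proof -
  obtain p m where f: "p \<in> M_plus F" "m \<in> M_minus F" "f = p + m" "J_M F f = p - m"
    by (rule J_M_decomp[OF assms])
  have "J_M F (r *\<^sub>R p + r *\<^sub>R m) = r *\<^sub>R p - r *\<^sub>R m"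
    using f csubspace_M_plus csubspace_M_minus
    by (intro J_M_eq frame) (auto simp: csubspace_def scaleR_scaleC)
  moreover have "r *\<^sub>R f = r *\<^sub>R p + r *\<^sub>R m" by (simp add: f(3) scaleR_right_distrib)
  ultimately show ?thesis unfolding f(4) by (simp add: scaleR_right_diff_distrib)
qed

text \<open>By orthogonality of the two subspaces, both sides equal
  \<open>Re (kprod p q) - Re (kprod m n)\<close>.\<close>

lemma Re_kprod_J_M_commute:
  assumes "f \<in> M_plus F + M_minus F" "g \<in> M_plus F + M_minus F"
  shows "Re (kprod (J_M F f) g) = Re (kprod (J_M F g) f)"
proof -
  obtain p m where f: "p \<in> M_plus F" "m \<in> M_minus F" "f = p + m" "J_M F f = p - m"
    by (rule J_M_decomp[OF assms(1)])
  obtain q n where g: "q \<in> M_plus F" "n \<in> M_minus F" "g = q + n" "J_M F g = q - n"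
    by (rule J_M_decomp[OF assms(2)])
  have 0: "Re (kprod p n) = 0" "Re (kprod q m) = 0"
    using M_plus_M_minus_orthogonal f g by auto
  have "Re (kprod (p - m) (q + n)) = Re (kprod (q - n) (p + m))"
    using 0 Re_kprod_commute[of m q] Re_kprod_commute[of n p] Re_kprod_commute[of p q]
      Re_kprod_commute[of m n]
    by (simp add: kprod_add_left kprod_add_right kprod_diff_left kprod_diff_right)
  then show ?thesis unfolding f(4) g(4) by (simp add: f(3) g(3))
qed

text \<open>This is the positivity of \<open>exp_Q F\<close>: the value is
  \<open>Re (kprod p p) - Re (kprod m m)\<close>.\<close>

lemma Re_kprod_J_M_nonneg:
  assumes "f \<in> M_plus F + M_minus F"
  shows "0 \<le> Re (kprod (J_M F f) f)"
proof -
  obtain p m where f: "p \<in> M_plus F" "m \<in> M_minus F" "f = p + m" "J_M F f = p - m"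
    by (rule J_M_decomp[OF assms])
  have "Re (kprod p m) = 0" using M_plus_M_minus_orthogonal f by auto
  then have "Re (kprod (p - m) (p + m)) = Re (kprod p p) - Re (kprod m m)"
    using Re_kprod_commute[of m p] by (simp add: kprod_add_right kprod_diff_left)
  then show ?thesis
    unfolding f(4) using f(3) M_plus_nonneg[OF f(1)] M_minus_nonpos[OF f(2)] by simp
qed

text \<open>A bound on the form passes to \<open>J_M\<close>, by the Cauchy-Schwarz inequality and
  density, and from there to the projection onto \<open>M_plus F\<close>.\<close>

lemma energetic_form_unbounded:
  assumes "M_plus F + M_minus F \<noteq> UNIV"
  shows "\<exists>f\<in>M_plus F + M_minus F. M * (norm f)\<^sup>2 < energetic_form f f"
proof (rule ccontr)
  let ?D = "M_plus F + M_minus F"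
  assume "\<not> ?thesis"
  then have "energetic_form f f \<le> M * (norm f)\<^sup>2" if "f \<in> ?D" for f
    using that by (meson not_le)
  then have "Re (kprod (J_M F f) f) \<le> M * (norm f)\<^sup>2" if "f \<in> ?D" for f
    using that power2_norm_eq_kprod[of f] zero_le_power2[of "norm f"]
    unfolding energetic_form_def by (smt (verit))
  then have M: "Re (kprod (J_M F f) f) \<le> \<bar>M\<bar> * (norm f)\<^sup>2" if "f \<in> ?D" for f
    using that by (meson abs_ge_self mult_right_mono order_trans zero_le_power2)
  have bound: "norm (J_M F f) \<le> \<bar>M\<bar> * norm f" if f: "f \<in> ?D" for f
  proof -
    \<comment> \<open>Testing against \<open>h\<close> gives \<open>(norm h)\<^sup>2\<close>. As
      \<open>h\<close> may lie outside the domain of \<open>J_M\<close>, it is approximated by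
      vectors \<open>g n\<close> of that domain.\<close>
    define h where "h = fund_sym (J_M F f)"
    obtain g where g: "\<forall>n. g n \<in> ?D" "g \<longlonglongrightarrow> h"
      using M_plus_M_minus_dense closure_sequential[of h ?D] by auto
    have "(Re (kprod (J_M F f) (g n)))\<^sup>2 \<le> \<bar>M\<bar> * (norm f)\<^sup>2 * (\<bar>M\<bar> * (norm (g n))\<^sup>2)" for n
    proof -
      have "(Re (kprod (J_M F f) (g n)))\<^sup>2 \<le> Re (kprod (J_M F f) f) * Re (kprod (J_M F (g n)) (g n))"
        using csubspace_imp_subspace[OF csubspace_sum] Re_kprod_J_M_commute Re_kprod_J_M_nonneg f g(1)
        by (intro real_form_Cauchy_Schwarz[where V = ?D and b = "\<lambda>f g. Re (kprod (J_M F f) g)"])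
          (auto simp: J_M_add J_M_scaleR kprod_add_left kprod_scaleR_left)
      also have "\<dots> \<le> \<bar>M\<bar> * (norm f)\<^sup>2 * (\<bar>M\<bar> * (norm (g n))\<^sup>2)"
        using f g(1) M Re_kprod_J_M_nonneg by (intro mult_mono) auto
      finally show ?thesis .
    qed
    moreover have "(\<lambda>n. (Re (kprod (J_M F f) (g n)))\<^sup>2) \<longlonglongrightarrow> (Re (kprod (J_M F f) h))\<^sup>2"
      using g(2) by (intro tendsto_intros kprod.tendsto)
    moreover have "(\<lambda>n. \<bar>M\<bar> * (norm f)\<^sup>2 * (\<bar>M\<bar> * (norm (g n))\<^sup>2)) \<longlonglongrightarrow>
        \<bar>M\<bar> * (norm f)\<^sup>2 * (\<bar>M\<bar> * (norm h)\<^sup>2)"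
      using g(2) by (intro tendsto_intros)
    ultimately have "(Re (kprod (J_M F f) h))\<^sup>2 \<le> \<bar>M\<bar> * (norm f)\<^sup>2 * (\<bar>M\<bar> * (norm h)\<^sup>2)"
      by (intro LIMSEQ_le) auto
    moreover have "Re (kprod (J_M F f) h) = (norm h)\<^sup>2"
      unfolding power2_norm_eq_kprod h_def by simp
    moreover have "\<bar>M\<bar> * (norm f)\<^sup>2 * (\<bar>M\<bar> * (norm h)\<^sup>2) = (\<bar>M\<bar> * norm f * norm h)\<^sup>2"
      by (simp only: power2_eq_square mult_ac)
    ultimately have "((norm h)\<^sup>2)\<^sup>2 \<le> (\<bar>M\<bar> * norm f * norm h)\<^sup>2" by simp
    then have "(norm h)\<^sup>2 \<le> \<bar>M\<bar> * norm f * norm h" by (rule power2_le_imp_le) simp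
    then have "norm h * norm h \<le> \<bar>M\<bar> * norm f * norm h" by (simp add: power2_eq_square)
    then have "norm h \<le> \<bar>M\<bar> * norm f"
      by (cases "h = 0") (auto intro: mult_right_le_imp_le)
    then show ?thesis by (simp add: h_def)
  qed
  have "?D = UNIV"
  proof (rule plus_eq_UNIV_if_projection_bounded)
    fix p m assume p: "p \<in> M_plus F" and m: "m \<in> M_minus F"
    have "norm (p - m) \<le> \<bar>M\<bar> * norm (p + m)"
      using bound[OF set_plus_intro[OF p m]] J_M_eq[OF frame p m] by simp
    \<comment> \<open>Twice the projection \<open>p\<close> is the sum of \<open>p + m\<close> and
      its reflection \<open>p - m\<close>.\<close>
    moreover have "2 * norm p \<le> norm (p + m) + norm (p - m)"
      using norm_triangle_ineq[of "p + m" "p - m"] by (simp flip: scaleR_2)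
    ultimately show "norm p \<le> (1 + \<bar>M\<bar>) / 2 * norm (p + m)" by (simp add: field_simps)
  qed
  then show False using assms by simp
qed

text \<open>Constant sequences give the inclusion; the unbounded form supplies an energetic Cauchy
  sequence whose limit leaves the sum.\<close>

lemma sum_psubset_energetic_manifold:
  assumes "M_plus F + M_minus F \<noteq> UNIV"
  shows "M_plus F + M_minus F \<subset> energetic_manifold F"
proof
  let ?D = "M_plus F + M_minus F"
  have D: "subspace ?D" using csubspace_imp_subspace[OF csubspace_sum] .
  show "?D \<subseteq> energetic_manifold F"
  proof
    fix f assume f: "f \<in> ?D"
    have "energetic_norm F 0 = 0" by (simp add: energetic_norm_eq energetic_form_def kprod.zero_right)
    then have "energetic_Cauchy F (\<lambda>n. f)" by (simp add: energetic_Cauchy_def)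
    then show "f \<in> energetic_manifold F"
      using f unfolding energetic_manifold_def by (auto intro!: exI[of _ "\<lambda>n. f"])
  qed
  obtain f g where fg: "f \<notin> ?D" "\<And>n. g n \<in> ?D" "g \<longlonglongrightarrow> f"
    "\<And>e. 0 < e \<Longrightarrow> \<exists>N. \<forall>m\<ge>N. \<forall>n\<ge>N. sqrt (energetic_form (g m - g n) (g m - g n)) < e"
  proof (rule unbounded_form_limit_outside[OF D])
    show "energetic_form (x + y) z = energetic_form x z + energetic_form y z"
      if "x \<in> ?D" "y \<in> ?D" "z \<in> ?D" for x y z
      using that by (simp add: energetic_form_def J_M_add fund_sym_add kprod_add_left)
    show "energetic_form (r *\<^sub>R x) z = r * energetic_form x z" if "x \<in> ?D" "z \<in> ?D" for r x z
      using that by (simp add: energetic_form_def J_M_scaleR fund_sym_scaleR kprod_scaleR_left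
          distrib_left)
    show "energetic_form x y = energetic_form y x" if "x \<in> ?D" "y \<in> ?D" for x y
    proof -
      have "Re (kprod (fund_sym x) y) = Re (kprod (fund_sym y) x)"
        using kprod_fund_sym Re_kprod_commute by metis
      then show ?thesis using Re_kprod_J_M_commute[OF that] by (simp add: energetic_form_def)
    qed
    show "(norm x)\<^sup>2 \<le> energetic_form x x" if "x \<in> ?D" for x
      using Re_kprod_J_M_nonneg[OF that] by (simp add: energetic_form_def power2_norm_eq_kprod)
    \<comment> \<open>For fixed \<open>x\<close> the form is norm-bounded in \<open>y\<close>,
      because \<open>J_M F x\<close> is a fixed vector of the space.\<close>
    show "\<exists>C. \<forall>y\<in>?D. \<bar>energetic_form x y\<bar> \<le> C * norm y" if "x \<in> ?D" for x
    proof (intro exI ballI)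
      fix y
      have "\<bar>energetic_form x y\<bar> \<le> \<bar>Re (kprod (fund_sym x) y)\<bar> + \<bar>Re (kprod (J_M F x) y)\<bar>"
        by (simp add: energetic_form_def)
      also have "\<dots> \<le> norm (fund_sym x) * norm y + norm (J_M F x) * norm y"
        by (intro add_mono order_trans[OF abs_Re_le_cmod norm_kprod_le])
      finally show "\<bar>energetic_form x y\<bar> \<le> (norm x + norm (J_M F x)) * norm y"
        by (simp add: distrib_right)
    qed
    show "\<exists>x\<in>?D. M * (norm x)\<^sup>2 < energetic_form x x" for M
      using energetic_form_unbounded[OF assms] .
  qed (rule that)
  then have "f \<in> energetic_manifold F"
    unfolding energetic_manifold_def energetic_Cauchy_def energetic_norm_eq by blast
  then show "?D \<noteq> energetic_manifold F" using fg(1) by blast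
qed

end

theorem theorem4p9:
  fixes F :: "nat \<Rightarrow> 'a::krein_space"
  assumes "J_orthogonal F"
    and "schauder_basis F"
    and "J_frame F"
    and "M_plus F + M_minus F \<noteq> UNIV"
  shows "D_un F \<subset> M_plus F + M_minus F \<and>
         M_plus F + M_minus F \<subset> energetic_manifold F \<and>
         (\<forall>f. summable (\<lambda>n. cmod (kprod f (F n))) \<longrightarrow> f \<in> D_un F)"
proof -
  interpret J_orthogonal_frame_basis F by unfold_locales (fact assms)+
  show ?thesis
    using D_un_psubset[OF assms(4)] sum_psubset_energetic_manifold[OF assms(4)] summable_imp_D_un
    by blast
qed

end
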